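(* Suppose that $\alpha \in \mathbb R\setminus\mathbb Q$, let $\{a_n/q_n\}_{n=1}^\infty$ be the sequence of best rational approximations to $\alpha$, and let $\mathcal Q_\alpha$ be the set of even denominators $q_n$ such that $q_{n+1}\ge 2q_n$. When $0 < p \le 1$, the series \[ \sum_{n=1}^{\infty} \frac{(-1)^n |\sin(n\pi\alpha)|}{n^p} \] converges if and only if the series \[ \sum_{q_n \in \mathcal Q_\alpha} \frac{1}{q_n^2} \int_1^{q_{n+1}} x^{-p}\,dx \] converges.
   Context: For $\alpha\in\mathbb R$, $\|\alpha\| = \min\{|\alpha - n| : n \in \mathbb Z\}$ denotes the distance from $\alpha$ to the nearest integer. For irrational $\alpha$, the sequence $\{a_n/q_n\}_{n=1}^\infty$ of best rational approximations to $\alpha$ is the unique sequence of rational numbers (with $a_n \in \mathbb Z$ and positive integers $1 = q_1 < q_2 < \cdots$) such that $|q_n\alpha - a_n| = \|q_n\alpha\|$ for all $n$ and, for all $n \ge 2$, \[ \min\{\|q\alpha\| : q\in\mathbb Z,\ 0 < q < q_n\} = \|q_{n-1}\alpha\| > \|q_n\alpha\|. \] The sum over $q_n\in\mathcal Q_\alpha$ runs over the indices $n$ with $q_n$ even and $q_{n+1}\ge 2q_n$ (it may be a finite or empty sum, in which case it converges). *)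

theory Defs
  imports "HOL-Analysis.Analysis"
begin

definition nearest_int_dist :: "real \<Rightarrow> real" where
  "nearest_int_dist x = (INF n::int. \<bar>x - of_int n\<bar>)"

text \<open>The infimum is attained, so it is the minimum over all integers.\<close>

lemma nearest_int_dist_le: "nearest_int_dist x \<le> \<bar>x - of_int n\<bar>"
  unfolding nearest_int_dist_def by (rule cINF_lower) (auto intro!: bdd_belowI[of _ 0])

lemma nearest_int_dist_eq_round: "nearest_int_dist x = \<bar>x - of_int (round x)\<bar>"
proof (rule antisym)
  show "nearest_int_dist x \<le> \<bar>x - of_int (round x)\<bar>"
    by (rule nearest_int_dist_le)
  show "\<bar>x - of_int (round x)\<bar> \<le> nearest_int_dist x"
    unfolding nearest_int_dist_def by (rule cINF_greatest) (auto simp: round_diff_minimal)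
qed

text \<open>
  Sequences are indexed from 1; the values \<open>a 0\<close> and \<open>q 0\<close> are irrelevant.
  For \<open>n \<ge> 2\<close> the set under \<open>Min\<close> is finite and, since \<open>q n > 1\<close>, nonempty.
\<close>

definition best_approximations :: "real \<Rightarrow> (nat \<Rightarrow> int) \<Rightarrow> (nat \<Rightarrow> nat) \<Rightarrow> bool" where
  "best_approximations \<alpha> a q \<longleftrightarrow>
     q 1 = 1 \<and>
     (\<forall>n\<ge>1. q n < q (n + 1)) \<and>
     (\<forall>n\<ge>1. \<bar>real (q n) * \<alpha> - of_int (a n)\<bar> = nearest_int_dist (real (q n) * \<alpha>)) \<and>
     (\<forall>n\<ge>2. Min ((\<lambda>k. nearest_int_dist (real k * \<alpha>)) ` {0<..<q n})
               = nearest_int_dist (real (q (n - 1)) * \<alpha>) \<and>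
             nearest_int_dist (real (q (n - 1)) * \<alpha>) > nearest_int_dist (real (q n) * \<alpha>))"

text \<open>The set of even denominators \<open>q n\<close> with \<open>q (n + 1) \<ge> 2 q n\<close>, given by its indices.\<close>

definition large_gap_even_indices :: "(nat \<Rightarrow> nat) \<Rightarrow> nat set" where
  "large_gap_even_indices q = {n. n \<ge> 1 \<and> even (q n) \<and> q (n + 1) \<ge> 2 * q n}"

end

theory Submission
  imports Defs "HOL-Analysis.Kronecker_Approximation_Theorem"
begin

text \<open>
  The proof compares both series with a third one, indexed by frequencies.  The absolute sine has the
  cosine series \<open>\<bar>sin x\<bar> = 2 / pi - (4 / pi) * (\<Sum>k\<ge>1. cos (2 * k * x) / (4 * k\<^sup>2 - 1))\<close>
  (\<open>abs_sin_cosine_series\<close>).  Inserting \<open>x = n * pi * \<alpha>\<close> and multiplying by \<open>(- 1) ^ n\<close> turns the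
  sine series, apart from a convergent alternating series, into \<open>- 4 / pi\<close> times
  \<open>\<Sum>k. C k / (4 * k\<^sup>2 - 1)\<close>, where \<open>C k\<close> is the sum over \<open>n\<close> of
  \<open>n powr (- p) * cos (2 * pi * n * b)\<close> with \<open>b = k * \<alpha> + 1/2\<close>
  (\<open>shifted_fourier_expansion\<close>).  If \<open>b\<close> has distance about \<open>1 / L\<close> from the integers, then
  \<open>C k\<close> is, up to a bounded error, of the order of \<open>H(L) = \<Sum>n\<le>L. n powr (- p)\<close>, essentially the integral of
  \<open>x powr (- p)\<close> over \<open>{1..L}\<close>.

  Convergence follows from \<open>\<Sum>k. H(L k) / k\<^sup>2 < \<infinity>\<close> by dominated convergence, since \<open>H(L)\<close> bounds all
  partial sums of \<open>C k\<close> (\<open>abs_weighted_cos_sum_le\<close>, \<open>summable_alternating_sine_if\<close>).  For the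
  converse one needs that different frequencies do not cancel.  This is achieved by Cesaro means:
  their weights are convex, and two summations by parts write the tapered cosine sums as
  nonnegative combinations of Fejer sums, up to a bounded error.  A convergent sine series therefore
  bounds the sum over any finite set of frequencies (\<open>fejer_energy_sum_bounded\<close>), while a single
  frequency contributes at least a constant times \<open>H(L)\<close> (\<open>power_sum_le_fejer_energy\<close>).

  The link with best approximations is that \<open>k * \<alpha> + 1/2\<close> is close to an integer exactly when
  \<open>m * \<alpha>\<close>, for \<open>m = 2 * k\<close>, is close to an odd integer.  An even \<open>q n\<close> has an odd numerator, so
  \<open>m = q n\<close> gives such a frequency with \<open>L\<close> of size at least about \<open>q (n + 1)\<close>.  Conversely,
  if \<open>m * \<alpha>\<close> is closer than \<open>1 / (2 * m)\<close> to an odd integer, then \<open>m\<close> is an odd multiple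
  \<open>j * q n\<close> of an even denominator (\<open>nearest_int_dist_half_dichotomy\<close>), and these frequencies cost
  at most a constant times \<open>H(q (n + 1)) / (j * q n)\<^sup>2\<close>.  For all other \<open>k\<close> one has \<open>L \<le> 8 * k\<close>; because
  \<open>p > 0\<close>, the sum \<open>H(8 * k)\<close> is at most of order \<open>k powr (1 - p / 2)\<close>, so these frequencies always
  form a convergent series.  The same estimate disposes of the even denominators with
  \<open>q (n + 1) < 2 * q n\<close>.
\<close>

section \<open>The cosine series of the absolute sine\<close>

lemma two_sin_mult_sum_cos_odd:
  fixes x :: real
  shows "2 * sin x * (\<Sum>k<K. cos (real (2 * k + 1) * x)) = sin (real (2 * K) * x)"
proof (induction K)
  case (Suc K)
  have "2 * sin x * cos (real (2 * K + 1) * x) = sin (real (2 * Suc K) * x) - sin (real (2 * K) * x)"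
    using sin_diff_sin[of "real (2 * Suc K) * x" "real (2 * K) * x"] by (simp add: algebra_simps add_divide_distrib)
  with Suc show ?case by (simp add: algebra_simps)
qed simp

text \<open>
  The derivative of the partial sum is \<open>sin (2 K x) / (2 sin x)\<close>, which oscillates quickly.
  Adding the correction \<open>cos (2 K x) / (4 K sin x)\<close>, itself of size \<open>1 / K\<close>, cancels this and leaves
  a derivative of size \<open>1 / K\<close>.  So the limit does not depend on \<open>x\<close>, and at \<open>pi / 2\<close> the
  series is Leibniz's.
\<close>

lemma sine_square_wave:
  fixes x :: real
  assumes "0 < x" "x < pi"
  shows "(\<lambda>K. \<Sum>k<K. sin (real (2 * k + 1) * x) / real (2 * k + 1)) \<longlonglongrightarrow> pi / 4"
proof -
  define S where "S = (\<lambda>K t. \<Sum>k<K. sin (real (2 * k + 1) * t) / real (2 * k + 1))"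
  define G where "G = (\<lambda>K t. S K t + cos (real (2 * K) * t) / (4 * real K * sin t))"
  define I where "I = {min x (pi/2)..max x (pi/2)}"
  have sx: "sin x > 0" using assms by (simp add: sin_gt_zero)
  have sin_ge: "sin t \<ge> sin x" if "t \<in> I" for t
  proof (cases "x \<le> pi/2")
    case True
    with that have "x \<le> t" "t \<le> pi/2" by (auto simp: I_def)
    then show ?thesis using assms by (intro sin_monotone_2pi_le) auto
  next
    case False
    with that have "t \<le> x" "pi/2 \<le> t" by (auto simp: I_def)
    then have "sin (pi - x) \<le> sin (pi - t)" using assms by (intro sin_monotone_2pi_le) auto
    then show ?thesis by simp
  qed
  have bound: "\<bar>G K x - G K (pi/2)\<bar> \<le> 1 / (4 * real K * (sin x)\<^sup>2) * \<bar>x - pi/2\<bar>" if K: "K > 0" for K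
  proof -
    have "norm (G K x - G K (pi/2)) \<le> 1 / (4 * real K * (sin x)\<^sup>2) * norm (x - pi/2)"
    proof (rule field_differentiable_bound[where S = I])
      show "convex I" by (simp add: I_def)
      show "x \<in> I" "pi/2 \<in> I" by (auto simp: I_def)
    next
      fix t assume t: "t \<in> I"
      have st: "sin t > 0" using sin_ge[OF t] sx by linarith
      have C: "(\<Sum>k<K. cos (real (2 * k + 1) * t)) = sin (real (2 * K) * t) / (2 * sin t)"
        using two_sin_mult_sum_cos_odd[of t K] st by (simp add: field_simps)
      have "(S K has_field_derivative (\<Sum>k<K. cos (real (2 * k + 1) * t))) (at t within I)"
        unfolding S_def by (auto intro!: derivative_eq_intros sum.cong)
      moreover have "((\<lambda>t. cos (real (2 * K) * t) / (4 * real K * sin t)) has_field_derivative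
          (- sin (real (2 * K) * t) * real (2 * K) * (4 * real K * sin t)
             - cos (real (2 * K) * t) * (4 * real K * cos t)) / (4 * real K * sin t)\<^sup>2) (at t within I)"
        using st K by (auto intro!: derivative_eq_intros simp: power2_eq_square)
      ultimately have "(G K has_field_derivative ((\<Sum>k<K. cos (real (2 * k + 1) * t)) +
          (- sin (real (2 * K) * t) * real (2 * K) * (4 * real K * sin t)
             - cos (real (2 * K) * t) * (4 * real K * cos t)) / (4 * real K * sin t)\<^sup>2)) (at t within I)"
        unfolding G_def by (rule DERIV_add)
      also have "(\<Sum>k<K. cos (real (2 * k + 1) * t)) +
          (- sin (real (2 * K) * t) * real (2 * K) * (4 * real K * sin t)
             - cos (real (2 * K) * t) * (4 * real K * cos t)) / (4 * real K * sin t)\<^sup>2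
         = - cos (real (2 * K) * t) * cos t / (4 * real K * (sin t)\<^sup>2)"
        unfolding C using st K by (simp add: field_simps power2_eq_square)
      finally show "(G K has_field_derivative
          - cos (real (2 * K) * t) * cos t / (4 * real K * (sin t)\<^sup>2)) (at t within I)" .
      have "\<bar>cos (real (2 * K) * t) * cos t\<bar> \<le> 1 * 1"
        unfolding abs_mult by (intro mult_mono) auto
      moreover have "4 * real K * (sin x)\<^sup>2 \<le> 4 * real K * (sin t)\<^sup>2"
        using sin_ge[OF t] sx by (intro mult_left_mono power_mono) auto
      ultimately show "norm (- cos (real (2 * K) * t) * cos t / (4 * real K * (sin t)\<^sup>2))
          \<le> 1 / (4 * real K * (sin x)\<^sup>2)"
        using K sx st by (auto simp: abs_mult intro!: frac_le)
    qed
    then show ?thesis by simp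
  qed
  have lim0: "(\<lambda>K. c / real K) \<longlonglongrightarrow> 0" for c :: real
    by (rule lim_const_over_n)
  have "(\<lambda>K. G K x - G K (pi/2)) \<longlonglongrightarrow> 0"
  proof (rule Lim_null_comparison)
    show "\<forall>\<^sub>F K in sequentially. norm (G K x - G K (pi/2)) \<le> (1 / (4 * (sin x)\<^sup>2) * \<bar>x - pi/2\<bar>) / real K"
      using eventually_gt_at_top[of 0]
    proof eventually_elim
      case (elim K)
      then show ?case using bound[of K] sx by (simp add: field_simps)
    qed
  qed (rule lim0)
  moreover have "(\<lambda>K. cos (real (2 * K) * t) / (4 * real K * sin t)) \<longlonglongrightarrow> 0" for t
  proof (rule Lim_null_comparison)
    show "\<forall>\<^sub>F K in sequentially. norm (cos (real (2 * K) * t) / (4 * real K * sin t)) \<le> (1 / (4 * \<bar>sin t\<bar>)) / real K"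
      by (rule always_eventually) (auto simp: abs_mult divide_right_mono field_simps intro!: divide_right_mono)
  qed (rule lim0)
  note this[of x] this[of "pi/2"]
  ultimately have "(\<lambda>K. (G K x - G K (pi/2)) - cos (real (2 * K) * x) / (4 * real K * sin x)
       + cos (real (2 * K) * (pi/2)) / (4 * real K * sin (pi/2))) \<longlonglongrightarrow> 0 - 0 + 0"
    by (intro tendsto_intros)
  then have d: "(\<lambda>K. S K x - S K (pi/2)) \<longlonglongrightarrow> 0"
    by (simp add: G_def)
  have "sin (real (2 * k + 1) * (pi/2)) = (-1) ^ k" for k
  proof -
    have "real (2 * k + 1) * (pi/2) = pi/2 + real k * pi" by (simp add: field_simps)
    then show ?thesis by (simp only: sin_add) simp
  qed
  then have S2: "S K (pi/2) = (\<Sum>k<K. (-1)^k * 1 / real (k * 2 + 1))" for K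
    by (simp add: S_def mult.commute)
  have "summable (\<lambda>k. (-1)^k * 1 / real (k * 2 + 1) :: real)"
    using summable_arctan_series[of 1] by simp
  then have "(\<lambda>K. S K (pi/2)) \<longlonglongrightarrow> pi/4"
    unfolding S2 pi_series by (rule summable_LIMSEQ)
  from tendsto_add[OF d this] show ?thesis by (simp add: S_def)
qed

lemma abs_sin_add_int_pi: "\<bar>sin (x + of_int n * pi)\<bar> = \<bar>sin (x::real)\<bar>"
proof -
  have s: "sin (of_int n * pi) = 0" by (auto simp: sin_zero_iff_int2)
  then have "\<bar>cos (of_int n * pi)\<bar> = 1"
    using sin_cos_squared_add[of "of_int n * pi"] by (auto simp: power2_eq_1_iff)
  with s show ?thesis by (simp add: sin_add abs_mult)
qed

text \<open>
  Splitting \<open>1 / (4 k\<^sup>2 - 1)\<close> into partial fractions and summing by parts turns the partial sums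
  into \<open>sin x\<close> times those of the square wave.  Both sides are periodic with period \<open>pi\<close>, so it is
  enough to let the square wave act on \<open>[0, pi)\<close>, where the factor \<open>sin x\<close> takes care of the end point.
\<close>

lemma abs_sin_cosine_series:
  fixes x :: real
  shows "(\<lambda>k. cos (real (2 * Suc k) * x) / (4 * (real (Suc k))\<^sup>2 - 1)) sums (1/2 - pi/4 * \<bar>sin x\<bar>)"
proof -
  define S where "S = (\<lambda>K t. \<Sum>k<K. sin (real (2 * k + 1) * t) / real (2 * k + 1))"
  have partial: "(\<Sum>k<K. cos (real (2 * Suc k) * y) / (4 * (real (Suc k))\<^sup>2 - 1))
      = (1 - 2 * (sin y * S K y) - cos (real (2 * K) * y) / real (2 * K + 1)) / 2" for K y
  proof (induction K)
    case (Suc K)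
    have e: "4 * (real (Suc K))\<^sup>2 - 1 = real (2 * K + 1) * real (2 * Suc K + 1)"
      by (simp add: power2_eq_square algebra_simps)
    have "cos (real (2 * Suc K) * y) / (4 * (real (Suc K))\<^sup>2 - 1)
       = (cos (real (2 * Suc K) * y) / real (2 * K + 1) - cos (real (2 * Suc K) * y) / real (2 * Suc K + 1)) / 2"
      unfolding e by (simp add: divide_simps) (simp add: algebra_simps)
    moreover have "cos (real (2 * Suc K) * y) = cos (real (2 * K) * y) - 2 * sin (real (2 * K + 1) * y) * sin y"
      using cos_diff_cos[of "real (2 * K) * y" "real (2 * Suc K) * y"]
      by (simp add: algebra_simps add_divide_distrib)
    then have "cos (real (2 * Suc K) * y) / real (2 * K + 1) = cos (real (2 * K) * y) / real (2 * K + 1)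
        - 2 * (sin y * (sin (real (2 * K + 1) * y) / real (2 * K + 1)))"
      by (simp add: diff_divide_distrib)
    ultimately show ?case
      using Suc.IH by (simp add: S_def algebra_simps)
  qed (simp add: S_def)
  define y where "y = x - of_int \<lfloor>x / pi\<rfloor> * pi"
  have y: "0 \<le> y" "y < pi"
    using floor_divide_lower[of pi x] floor_divide_upper[of pi x] by (auto simp: y_def algebra_simps)
  have cos_eq: "cos (real (2 * Suc k) * x) = cos (real (2 * Suc k) * y)" for k
  proof -
    have "real (2 * Suc k) * x = real (2 * Suc k) * y + (2 * pi) * of_int (int (Suc k) * \<lfloor>x / pi\<rfloor>)"
      by (simp add: y_def algebra_simps)
    then show ?thesis
      by (simp only: cos_add cos_int_2pin sin_int_2pin mult_1_right mult_zero_right diff_zero)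
  qed
  have "x = y + of_int \<lfloor>x / pi\<rfloor> * pi" by (simp add: y_def)
  then have "\<bar>sin x\<bar> = \<bar>sin y\<bar>"
    by (metis abs_sin_add_int_pi)
  also have "\<dots> = sin y" using y by (simp add: sin_ge_zero)
  finally have sin_eq: "\<bar>sin x\<bar> = sin y" .
  have lim1: "(\<lambda>K. sin y * S K y) \<longlonglongrightarrow> sin y * (pi/4)"
  proof (cases "y = 0")
    case False
    then show ?thesis unfolding S_def using y by (intro tendsto_mult_left sine_square_wave) auto
  qed simp
  have lim2: "(\<lambda>K. cos (real (2 * K) * y) / real (2 * K + 1)) \<longlonglongrightarrow> 0"
  proof (rule Lim_null_comparison)
    show "\<forall>\<^sub>F K in sequentially. norm (cos (real (2 * K) * y) / real (2 * K + 1)) \<le> 1 / real (Suc K)"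
      by (rule always_eventually) (auto intro!: frac_le)
  qed (rule LIMSEQ_inverse_real_of_nat[unfolded inverse_eq_divide])
  from tendsto_divide[OF tendsto_diff[OF tendsto_diff[OF tendsto_const tendsto_mult_left[OF lim1]] lim2] tendsto_const, of 2 1 2]
  have "(\<lambda>K. (1 - 2 * (sin y * S K y) - cos (real (2 * K) * y) / real (2 * K + 1)) / 2)
      \<longlonglongrightarrow> (1 - 2 * (sin y * (pi/4)) - 0) / 2"
    by simp
  then show ?thesis
    unfolding sums_def cos_eq partial sin_eq by (simp add: field_simps)
qed

section \<open>Cosine sums with power weights\<close>

lemma abel_partial_sum_bound:
  fixes v x :: "nat \<Rightarrow> real"
  assumes dec: "\<And>i. v (Suc i) \<le> v i" and nonneg: "\<And>i. 0 \<le> v i"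
    and bound: "\<And>m. m \<le> N \<Longrightarrow> \<bar>\<Sum>i<m. x i\<bar> \<le> B"
  shows "\<bar>\<Sum>i<N. v i * x i\<bar> \<le> v 0 * B"
proof -
  have parts: "(\<Sum>i<n. v i * x i) = (\<Sum>i<n. (v i - v (Suc i)) * (\<Sum>j<Suc i. x j)) + v n * (\<Sum>j<n. x j)" for n
    by (induction n) (auto simp: algebra_simps)
  have "\<bar>\<Sum>i<N. v i * x i\<bar> \<le> (\<Sum>i<N. \<bar>(v i - v (Suc i)) * (\<Sum>j<Suc i. x j)\<bar>) + \<bar>v N * (\<Sum>j<N. x j)\<bar>"
    unfolding parts by (intro order_trans[OF abs_triangle_ineq] add_mono sum_abs order_refl)
  also have "\<dots> \<le> (\<Sum>i<N. (v i - v (Suc i)) * B) + v N * B"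
    unfolding abs_mult using dec nonneg
    by (intro add_mono sum_mono mult_mono) (auto intro!: bound simp del: sum.lessThan_Suc)
  also have "\<dots> = v 0 * B"
    by (simp only: sum_distrib_right[symmetric] sum_lessThan_telescope') (simp add: algebra_simps)
  finally show ?thesis .
qed

text \<open>
  This discrete form of \<open>1 + \<integral> x powr (- p)\<close> over \<open>{1..L}\<close> is subadditive in \<open>L\<close>, which absorbs every
  constant factor in the range.
\<close>

definition power_sum :: "real \<Rightarrow> nat \<Rightarrow> real" where
  "power_sum p L = (\<Sum>i<L. real (Suc i) powr (- p))"

lemma power_sum_nonneg: "0 \<le> power_sum p L"
  by (simp add: power_sum_def sum_nonneg)

lemma power_sum_mono: "L \<le> M \<Longrightarrow> power_sum p L \<le> power_sum p M"
  unfolding power_sum_def by (rule sum_mono2) auto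

lemma power_sum_add_le:
  assumes "0 \<le> p"
  shows "power_sum p (L + M) \<le> power_sum p L + power_sum p M"
proof -
  have "power_sum p (L + M) = power_sum p L + (\<Sum>i<M. real (Suc (L + i)) powr (- p))"
    unfolding power_sum_def by (induction M) auto
  also have "(\<Sum>i<M. real (Suc (L + i)) powr (- p)) \<le> power_sum p M"
    unfolding power_sum_def using assms by (intro sum_mono powr_mono2') auto
  finally show ?thesis by simp
qed

lemma power_sum_mult_le:
  assumes "0 \<le> p"
  shows "power_sum p (j * L) \<le> real j * power_sum p L"
proof (induction j)
  case (Suc j)
  have "power_sum p (Suc j * L) \<le> power_sum p L + power_sum p (j * L)"
    using power_sum_add_le[OF assms, of L "j * L"] by simp
  with Suc show ?case by (simp add: algebra_simps)
qed (simp add: power_sum_def)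

lemma mult_powr_le_power_sum:
  assumes "0 \<le> p"
  shows "real L * real L powr (- p) \<le> power_sum p L"
proof -
  have "(\<Sum>i<L. real L powr (- p)) \<le> power_sum p L"
    unfolding power_sum_def using assms by (intro sum_mono powr_mono2') auto
  then show ?thesis by simp
qed

text \<open>
  The exponent \<open>1 - p / 2\<close> is not sharp, but it is less than 1 and the bound is uniform up to
  \<open>p = 1\<close>, where the sum grows like a logarithm.  Any exponent below 1 serves the later comparison
  with a convergent series.
\<close>

lemma power_sum_le_powr:
  assumes "0 < p" "p \<le> 1"
  shows "power_sum p L \<le> 2 * real L powr (1 - p / 2)"
proof (induction L)
  case (Suc L)
  have "real (Suc L) powr (- p) \<le> real (Suc L) powr (- (p / 2))"
    using assms by (intro powr_mono) auto
  also have "\<dots> \<le> 2 * (real (Suc L) powr (1 - p / 2) - real L powr (1 - p / 2))"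
  proof (cases "L = 0")
    case False
    have "\<exists>z. real L < z \<and> z < real (Suc L) \<and> real (Suc L) powr (1 - p / 2) - real L powr (1 - p / 2)
        = (real (Suc L) - real L) * ((1 - p / 2) * z powr (1 - p / 2 - 1))"
      using False by (intro MVT2) (auto intro!: derivative_eq_intros)
    then obtain z where z: "real L < z" "z < real (Suc L)"
      "real (Suc L) powr (1 - p / 2) - real L powr (1 - p / 2) = (1 - p / 2) * z powr (- (p / 2))"
      by auto
    have "real (Suc L) powr (- (p / 2)) \<le> z powr (- (p / 2))"
      using z assms by (intro powr_mono2') auto
    also have "\<dots> \<le> 2 * ((1 - p / 2) * z powr (- (p / 2)))"
      using assms mult_right_mono[of 1 "2 * (1 - p/2)" "z powr (- (p / 2))"] by (simp only: mult.assoc) simp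
    finally show ?thesis using z by simp
  qed simp
  finally show ?case using Suc by (simp add: power_sum_def)
qed (simp add: power_sum_def)

lemma jordan_sine_inequality:
  assumes "0 \<le> x" "x \<le> pi / 2"
  shows "2 * x / pi \<le> sin x"
proof -
  have "concave_on {0..pi/2} sin"
    by (rule f''_le0_imp_concave[where f' = cos and f'' = "\<lambda>x. - sin x"])
       (auto intro!: derivative_eq_intros sin_ge_zero)
  from concave_onD[OF this, of "2 * x / pi" 0 "pi/2"] assms show ?thesis
    by (simp add: field_simps)
qed

lemma nearest_int_dist_bounds: "0 \<le> nearest_int_dist x" "nearest_int_dist x \<le> 1/2"
  using of_int_round_abs_le[of x] by (auto simp: nearest_int_dist_eq_round abs_minus_commute)

lemma abs_sin_ge_nearest_int_dist: "2 * nearest_int_dist x \<le> \<bar>sin (pi * x)\<bar>"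
proof -
  define d where "d = x - of_int (round x)"
  have d: "\<bar>d\<bar> = nearest_int_dist x" by (simp add: d_def nearest_int_dist_eq_round)
  have "pi * x = pi * d + of_int (round x) * pi" by (simp add: d_def algebra_simps)
  then have "\<bar>sin (pi * x)\<bar> = \<bar>sin (pi * d)\<bar>"
    by (metis abs_sin_add_int_pi)
  also have "\<dots> = \<bar>sin (pi * \<bar>d\<bar>)\<bar>" by (auto simp: abs_if)
  also have "\<dots> \<ge> 2 * (pi * \<bar>d\<bar>) / pi"
    using nearest_int_dist_bounds[of x]
    by (intro order_trans[OF jordan_sine_inequality]) (auto simp: d)
  finally show ?thesis using d by simp
qed

lemma two_sin_mult_sum_cos_even:
  fixes y :: real
  shows "2 * sin y * (\<Sum>i<m. cos (2 * real (s + i) * y)) = sin ((2 * real (s + m) - 1) * y) - sin ((2 * real s - 1) * y)"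
proof (induction m)
  case (Suc m)
  have "2 * sin y * cos (2 * real (s + m) * y) = sin ((2 * real (s + Suc m) - 1) * y) - sin ((2 * real (s + m) - 1) * y)"
    using sin_diff_sin[of "(2 * real (s + Suc m) - 1) * y" "(2 * real (s + m) - 1) * y"]
    by (simp add: algebra_simps add_divide_distrib)
  with Suc show ?case by (simp add: algebra_simps)
qed simp

lemma abs_sum_cos_le:
  fixes y :: real
  assumes "sin y \<noteq> 0"
  shows "\<bar>\<Sum>i<m. cos (2 * real (s + i) * y)\<bar> \<le> 1 / \<bar>sin y\<bar>"
proof -
  have "\<bar>2 * sin y * (\<Sum>i<m. cos (2 * real (s + i) * y))\<bar> \<le> 2"
    unfolding two_sin_mult_sum_cos_even
    using abs_sin_le_one[of "(2 * real (s + m) - 1) * y"] abs_sin_le_one[of "(2 * real s - 1) * y"] by linarith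
  then show ?thesis using assms by (simp add: abs_mult field_simps)
qed

lemma abs_weighted_cos_tail_le:
  fixes y :: real
  assumes "sin y \<noteq> 0" "0 \<le> p"
  shows "\<bar>\<Sum>i<m. real (Suc (L + i)) powr (- p) * cos (2 * real (Suc (L + i)) * y)\<bar> \<le> real (Suc L) powr (- p) / \<bar>sin y\<bar>"
proof -
  have "\<bar>\<Sum>i<m. real (Suc (L + i)) powr (- p) * cos (2 * real (Suc (L + i)) * y)\<bar>
     \<le> real (Suc (L + 0)) powr (- p) * (1 / \<bar>sin y\<bar>)"
    using assms abs_sum_cos_le[OF assms(1), where s = "Suc L"]
    by (intro abel_partial_sum_bound[where v = "\<lambda>i. real (Suc (L + i)) powr (- p)"]) (auto intro!: powr_mono2')
  then show ?thesis by simp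
qed

lemma sum_lessThan_add:
  fixes f :: "nat \<Rightarrow> real"
  shows "(\<Sum>i<L + m. f i) = (\<Sum>i<L. f i) + (\<Sum>i<m. f (L + i))"
  by (induction m) auto

lemma summable_weighted_cos:
  fixes y :: real
  assumes "sin y \<noteq> 0" "0 < p"
  shows "summable (\<lambda>i. real (Suc i) powr (- p) * cos (2 * real (Suc i) * y))"
  unfolding summable_Cauchy
proof (intro allI impI)
  fix e :: real assume "e > 0"
  let ?f = "\<lambda>i. real (Suc i) powr (- p) * cos (2 * real (Suc i) * y)"
  have "(\<lambda>L. real (Suc L) powr (- p) / \<bar>sin y\<bar>) \<longlonglongrightarrow> 0 / \<bar>sin y\<bar>"
    using assms by (intro tendsto_divide tendsto_const tendsto_neg_powr)
      (auto intro!: filterlim_compose[OF filterlim_real_sequentially filterlim_Suc] simp del: of_nat_Suc)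
  then have "\<forall>\<^sub>F L in sequentially. real (Suc L) powr (- p) / \<bar>sin y\<bar> < e"
    using \<open>e > 0\<close> by (auto simp: order_tendsto_iff)
  then obtain N where N: "\<And>L. L \<ge> N \<Longrightarrow> real (Suc L) powr (- p) / \<bar>sin y\<bar> < e"
    by (auto simp: eventually_sequentially)
  have "norm (sum ?f {m..<n}) < e" if "m \<ge> N" for m n
  proof (cases "m \<le> n")
    case True
    then have "sum ?f {m..<n} = (\<Sum>i<n - m. ?f (m + i))"
      using sum.shift_bounds_nat_ivl[of ?f 0 m "n - m"] by (simp add: atLeast0LessThan add.commute)
    then show ?thesis
      using abs_weighted_cos_tail_le[of y p m "n - m"] assms N[OF that] by simp
  qed (use \<open>e > 0\<close> in simp)
  then show "\<exists>N. \<forall>m\<ge>N. \<forall>n. norm (sum ?f {m..<n}) < e" by blast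
qed

text \<open>
  Up to index \<open>L\<close> the terms are estimated by their size.  Since \<open>L\<close> is at least the inverse distance
  of \<open>b\<close> from the integers, beyond it the cosines cancel, and by partial summation the rest is at most
  \<open>L * L powr (- p)\<close>.
\<close>

lemma abs_weighted_cos_sum_le:
  fixes b :: real
  assumes "0 \<le> p" "1 \<le> real L * nearest_int_dist b"
  shows "\<bar>\<Sum>i<N. real (Suc i) powr (- p) * cos (2 * real (Suc i) * (pi * b))\<bar> \<le> 2 * power_sum p L"
proof -
  let ?f = "\<lambda>i. real (Suc i) powr (- p) * cos (2 * real (Suc i) * (pi * b))"
  have head: "\<bar>\<Sum>i<M. ?f i\<bar> \<le> power_sum p M" for M
    unfolding power_sum_def
  proof (rule order_trans[OF sum_abs sum_mono])
    fix i show "\<bar>?f i\<bar> \<le> real (Suc i) powr (- p)"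
      using mult_left_mono[OF abs_cos_le_one, of "real (Suc i) powr (- p)"] by (simp add: abs_mult)
  qed
  show ?thesis
  proof (cases "N \<le> L")
    case True
    then show ?thesis using head[of N] power_sum_mono[OF True, of p] power_sum_nonneg[of p L] by linarith
  next
    case False
    then obtain m where N: "N = L + m" by (metis le_Suc_ex nat_le_linear)
    have L: "L > 0" using assms(2) by (cases L) auto
    have d: "nearest_int_dist b > 0"
      using assms(2) nearest_int_dist_bounds(1)[of b] by (cases "nearest_int_dist b = 0") auto
    then have s: "\<bar>sin (pi * b)\<bar> > 0" using abs_sin_ge_nearest_int_dist[of b] by linarith
    have "1 \<le> real L * \<bar>sin (pi * b)\<bar>"
      using mult_left_mono[OF abs_sin_ge_nearest_int_dist[of b], of "real L"] assms(2) by simp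
    then have "1 / \<bar>sin (pi * b)\<bar> \<le> real L" using s by (simp add: field_simps)
    have "\<bar>\<Sum>i<m. ?f (L + i)\<bar> \<le> real (Suc L) powr (- p) / \<bar>sin (pi * b)\<bar>"
      using s assms abs_weighted_cos_tail_le[of "pi * b" p L m] by simp
    also have "\<dots> \<le> real L powr (- p) * real L"
      using \<open>1 / \<bar>sin (pi * b)\<bar> \<le> real L\<close> assms L
      by (subst divide_inverse, intro mult_mono powr_mono2') (auto simp: inverse_eq_divide)
    also have "\<dots> \<le> power_sum p L" using mult_powr_le_power_sum[OF assms(1), of L] by (simp add: mult.commute)
    finally show ?thesis
      using head[of L] unfolding N sum_lessThan_add by linarith
  qed
qed

lemma abs_sum_alternating_le: "\<bar>\<Sum>i<m. (- 1) ^ Suc i :: real\<bar> \<le> 1"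
proof -
  have "(\<Sum>i<m. (- 1) ^ Suc i :: real) = (if even m then 0 else - 1)" by (induction m) auto
  then show ?thesis by simp
qed

text \<open>
  Multiplication by \<open>(- 1) ^ n\<close> moves the frequency \<open>k * \<alpha>\<close> of the cosine series by one half.  This is
  why only those \<open>k\<close> matter for which \<open>2 * k * \<alpha>\<close> is close to an odd integer.
\<close>

lemma shifted_fourier_expansion:
  fixes \<alpha> :: real and u :: "nat \<Rightarrow> real"
  shows "(\<lambda>k. (\<Sum>i<N. u i * cos (2 * real (Suc i) * (pi * (real (Suc k) * \<alpha> + 1/2)))) / (4 * (real (Suc k))\<^sup>2 - 1))
    sums ((\<Sum>i<N. u i * (- 1) ^ Suc i) / 2
          - pi / 4 * (\<Sum>i<N. u i * ((- 1) ^ Suc i * \<bar>sin (real (Suc i) * pi * \<alpha>)\<bar>)))"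
proof -
  have cos_eq: "cos (2 * real (Suc i) * (pi * (real (Suc k) * \<alpha> + 1/2)))
      = (- 1) ^ Suc i * cos (real (2 * Suc k) * (real (Suc i) * pi * \<alpha>))" for i k
  proof -
    have "2 * real (Suc i) * (pi * (real (Suc k) * \<alpha> + 1/2))
        = real (2 * Suc k) * (real (Suc i) * pi * \<alpha>) + real (Suc i) * pi"
      by (simp add: algebra_simps)
    then show ?thesis by (simp only: cos_add cos_npi sin_npi) simp
  qed
  have "(\<lambda>k. \<Sum>i<N. (u i * (- 1) ^ Suc i) *
          (cos (real (2 * Suc k) * (real (Suc i) * pi * \<alpha>)) / (4 * (real (Suc k))\<^sup>2 - 1)))
     sums (\<Sum>i<N. (u i * (- 1) ^ Suc i) * (1/2 - pi/4 * \<bar>sin (real (Suc i) * pi * \<alpha>)\<bar>))"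
    by (intro sums_sum sums_mult abs_sin_cosine_series)
  moreover have alg: "a * b * (1/2 - c * d) = a * b / 2 - c * (a * (b * d))" for a b c d :: real
    by (simp add: algebra_simps)
  have "(\<Sum>i<N. (u i * (- 1) ^ Suc i) * (1/2 - pi/4 * \<bar>sin (real (Suc i) * pi * \<alpha>)\<bar>))
     = (\<Sum>i<N. u i * (- 1) ^ Suc i) / 2
          - pi / 4 * (\<Sum>i<N. u i * ((- 1) ^ Suc i * \<bar>sin (real (Suc i) * pi * \<alpha>)\<bar>))"
    unfolding sum_distrib_left sum_divide_distrib sum_subtractf[symmetric]
    by (rule sum.cong[OF refl], rule alg)
  ultimately show ?thesis
    unfolding cos_eq sum_divide_distrib by (simp only: mult.assoc times_divide_eq_right)
qed

lemma irrational_shift: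
  assumes "\<alpha> \<notin> \<rat>"
  shows "real (Suc k) * \<alpha> + 1/2 \<notin> \<rat>"
proof
  assume "real (Suc k) * \<alpha> + 1/2 \<in> \<rat>"
  then have "(real (Suc k) * \<alpha> + 1/2 - 1/2) / real (Suc k) \<in> \<rat>"
    by (intro Rats_divide Rats_diff) auto
  with assms show False by simp
qed

lemma nearest_int_dist_pos:
  assumes "b \<notin> \<rat>" shows "0 < nearest_int_dist b"
proof -
  have "b \<noteq> of_int (round b)" using assms by (metis Rats_of_int)
  then show ?thesis by (simp add: nearest_int_dist_eq_round)
qed

lemma sin_pi_mult_nonzero: "b \<notin> \<rat> \<Longrightarrow> sin (pi * b) \<noteq> 0"
  using nearest_int_dist_pos[of b] abs_sin_ge_nearest_int_dist[of b] by auto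

lemma four_square_minus_one_pos: "0 < 4 * (real (Suc k))\<^sup>2 - 1"
proof -
  have "1 \<le> (real (Suc k))\<^sup>2" by (rule one_le_power) simp
  then show ?thesis by linarith
qed

text \<open>
  Every single frequency contributes a convergent cosine series, so the matter is to exchange the
  limit with the sum over the frequencies.  The hypothesis provides the dominating series for
  Tannery's theorem.
\<close>

lemma summable_alternating_sine_if:
  fixes \<alpha> p :: real and L :: "nat \<Rightarrow> nat"
  assumes irr: "\<alpha> \<notin> \<rat>" and p: "0 < p"
    and L: "\<And>k. 1 \<le> real (L k) * nearest_int_dist (real (Suc k) * \<alpha> + 1/2)"
    and summ: "summable (\<lambda>k. power_sum p (L k) / (4 * (real (Suc k))\<^sup>2 - 1))"
  shows "summable (\<lambda>i. (- 1) ^ Suc i * \<bar>sin (real (Suc i) * pi * \<alpha>)\<bar> / real (Suc i) powr p)"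
proof -
  define y where "y = (\<lambda>k. pi * (real (Suc k) * \<alpha> + 1/2))"
  define w where "w = (\<lambda>i. real (Suc i) powr (- p))"
  define C where "C = (\<lambda>k N. (\<Sum>i<N. w i * cos (2 * real (Suc i) * y k)) / (4 * (real (Suc k))\<^sup>2 - 1))"
  define A where "A = (\<lambda>N. \<Sum>i<N. w i * ((- 1) ^ Suc i * \<bar>sin (real (Suc i) * pi * \<alpha>)\<bar>))"
  have expansion: "(\<lambda>k. C k N) sums ((\<Sum>i<N. w i * (- 1) ^ Suc i) / 2 - pi / 4 * A N)" for N
    unfolding C_def A_def y_def by (rule shifted_fourier_expansion)
  have "\<exists>b. C k \<longlonglongrightarrow> b" for k
  proof -
    have "summable (\<lambda>i. w i * cos (2 * real (Suc i) * y k))"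
      unfolding w_def y_def using sin_pi_mult_nonzero[OF irrational_shift[OF irr]] p by (intro summable_weighted_cos)
    from tendsto_divide[OF summable_LIMSEQ[OF this] tendsto_const, of "4 * (real (Suc k))\<^sup>2 - 1"]
    show ?thesis using four_square_minus_one_pos[of k] unfolding C_def by (metis less_numeral_extra(3))
  qed
  then obtain b where b: "\<And>k. C k \<longlonglongrightarrow> b k" by metis
  have "\<bar>C k N\<bar> \<le> 2 * (power_sum p (L k) / (4 * (real (Suc k))\<^sup>2 - 1))" for k N
    using divide_right_mono[OF abs_weighted_cos_sum_le[OF less_imp_le[OF p] L[of k], of N]
        less_imp_le[OF four_square_minus_one_pos[of k]]]
    by (simp only: C_def y_def w_def abs_divide abs_of_pos[OF four_square_minus_one_pos] times_divide_eq_right)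
  then have bound: "\<forall>\<^sub>F (k, N) in at_top \<times>\<^sub>F sequentially. norm (C k N) \<le> 2 * (power_sum p (L k) / (4 * (real (Suc k))\<^sup>2 - 1))"
    by (intro always_eventually) auto
  have "(\<lambda>N. \<Sum>k. C k N) \<longlonglongrightarrow> suminf b"
    using tannerys_theorem[OF b bound summable_mult[OF summ]] by simp
  moreover have "(\<Sum>k. C k N) = (\<Sum>i<N. w i * (- 1) ^ Suc i) / 2 - pi / 4 * A N" for N
    using expansion by (rule sums_unique[symmetric])
  ultimately have lim: "(\<lambda>N. (\<Sum>i<N. w i * (- 1) ^ Suc i) / 2 - pi / 4 * A N) \<longlonglongrightarrow> suminf b"
    by simp
  have "w \<longlonglongrightarrow> 0"
    unfolding w_def using p
    by (intro tendsto_neg_powr) (auto intro!: filterlim_compose[OF filterlim_real_sequentially filterlim_Suc] simp del: of_nat_Suc)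
  moreover have "monoseq w"
    unfolding w_def using p by (intro decseq_imp_monoseq decseq_SucI powr_mono2') auto
  ultimately have "summable (\<lambda>i. (- 1) ^ i * w i)" by (rule summable_Leibniz(1))
  from summable_minus[OF this] have "summable (\<lambda>i. w i * (- 1) ^ Suc i)" by (simp add: mult.commute)
  from tendsto_diff[OF tendsto_divide[OF summable_LIMSEQ[OF this] tendsto_const] lim, of 2]
  have "\<exists>l. (\<lambda>N. pi / 4 * A N) \<longlonglongrightarrow> l" by auto
  then obtain l where "(\<lambda>N. pi / 4 * A N) \<longlonglongrightarrow> l" by blast
  from tendsto_mult_left[OF this, of "4 / pi"] have "A \<longlonglongrightarrow> 4 / pi * l" by simp
  then have "summable (\<lambda>i. w i * ((- 1) ^ Suc i * \<bar>sin (real (Suc i) * pi * \<alpha>)\<bar>))"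
    unfolding A_def using sums_def sums_summable by blast
  then show ?thesis by (simp add: w_def powr_minus field_simps)
qed

section \<open>Fejer sums and the lower bound\<close>

text \<open>
  This is \<open>N / 2\<close> times the Fejer kernel at the angle \<open>2 * y\<close>.
\<close>

definition fejer_sum :: "nat \<Rightarrow> real \<Rightarrow> real" where
  "fejer_sum N y = (\<Sum>m<N. 1/2 + (\<Sum>i<m. cos (2 * real (Suc i) * y)))"

lemma sin_add_mult_sin_diff: "sin (a + b) * sin (a - b) = (sin a)\<^sup>2 - (sin (b::real))\<^sup>2"
proof -
  have "sin (a + b) * sin (a - b) = (sin a)\<^sup>2 * (cos b)\<^sup>2 - (cos a)\<^sup>2 * (sin b)\<^sup>2"
    by (simp add: sin_add sin_diff power2_eq_square algebra_simps)
  then show ?thesis by (simp add: cos_squared_eq algebra_simps)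
qed

lemma fejer_sum_closed_form: "2 * (sin y)\<^sup>2 * fejer_sum N y = (sin (real N * y))\<^sup>2"
proof (induction N)
  case (Suc N)
  have "2 * sin y * (1/2 + (\<Sum>i<N. cos (2 * real (Suc i) * y))) = sin (real (Suc N) * y + real N * y)"
    using two_sin_mult_sum_cos_even[of y 1 N] by (simp add: algebra_simps)
  then have "2 * (sin y)\<^sup>2 * (1/2 + (\<Sum>i<N. cos (2 * real (Suc i) * y))) = sin (real (Suc N) * y + real N * y) * sin y"
    by (metis mult.assoc mult.commute power2_eq_square)
  also have "\<dots> = sin (real (Suc N) * y + real N * y) * sin (real (Suc N) * y - real N * y)"
    by (simp add: algebra_simps)
  also have "\<dots> = (sin (real (Suc N) * y))\<^sup>2 - (sin (real N * y))\<^sup>2"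
    by (rule sin_add_mult_sin_diff)
  finally show ?case using Suc by (simp add: fejer_sum_def algebra_simps)
qed (simp add: fejer_sum_def)

lemma fejer_sum_nonneg:
  assumes "sin y \<noteq> 0"
  shows "0 \<le> fejer_sum N y"
proof -
  have "0 \<le> 2 * (sin y)\<^sup>2 * fejer_sum N y" by (simp add: fejer_sum_closed_form)
  with assms show ?thesis by (simp add: zero_le_mult_iff)
qed

text \<open>
  As long as \<open>N * b\<close> is within half a unit of \<open>N\<close> times the integer nearest to \<open>b\<close>, the sine in the
  numerator of the closed form is bounded below by the chord and the one in the denominator above by
  the tangent.
\<close>

lemma fejer_sum_ge:
  assumes "sin (pi * b) \<noteq> 0" "2 * real N * nearest_int_dist b \<le> 1"
  shows "2 * (real N)\<^sup>2 / pi\<^sup>2 \<le> fejer_sum N (pi * b)"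
proof -
  define d where "d = b - of_int (round b)"
  have d: "\<bar>d\<bar> = nearest_int_dist b" by (simp add: d_def nearest_int_dist_eq_round)
  have "pi * b = pi * d + of_int (round b) * pi" by (simp add: d_def algebra_simps)
  then have "\<bar>sin (pi * b)\<bar> = \<bar>sin (pi * d)\<bar>"
    by (metis abs_sin_add_int_pi)
  also have "\<dots> \<le> pi * \<bar>d\<bar>"
    using abs_sin_x_le_abs_x[of "pi * d"] by (simp add: abs_mult)
  finally have upper: "\<bar>sin (pi * b)\<bar> \<le> pi * \<bar>d\<bar>" .
  have "real N * (pi * b) = real N * (pi * d) + of_int (int N * round b) * pi"
    by (simp add: d_def algebra_simps)
  then have "\<bar>sin (real N * (pi * b))\<bar> = \<bar>sin (real N * (pi * d))\<bar>"
    by (metis abs_sin_add_int_pi)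
  also have "\<dots> = \<bar>sin (real N * (pi * \<bar>d\<bar>))\<bar>" by (auto simp: abs_if)
  also have "\<dots> \<ge> 2 * (real N * (pi * \<bar>d\<bar>)) / pi"
    using assms(2) d
    by (intro order_trans[OF jordan_sine_inequality abs_ge_self]) (auto simp: field_simps)
  finally have lower: "2 * real N * \<bar>d\<bar> \<le> \<bar>sin (real N * (pi * b))\<bar>" by simp
  have "\<bar>d\<bar> > 0" using upper assms(1) by (cases "d = 0") auto
  have "2 * (real N)\<^sup>2 / pi\<^sup>2 * (2 * (sin (pi * b))\<^sup>2) \<le> 2 * (real N)\<^sup>2 / pi\<^sup>2 * (2 * (pi * \<bar>d\<bar>)\<^sup>2)"
    using upper by (intro mult_left_mono) (auto simp: abs_le_square_iff[symmetric] abs_mult)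
  also have "\<dots> = (2 * real N * \<bar>d\<bar>)\<^sup>2" by (simp add: power2_eq_square)
  also have "\<dots> \<le> (sin (real N * (pi * b)))\<^sup>2"
    using lower by (auto simp: abs_le_square_iff[symmetric] abs_mult)
  also have "\<dots> = fejer_sum N (pi * b) * (2 * (sin (pi * b))\<^sup>2)"
    using fejer_sum_closed_form[of "pi * b" N] by (simp add: mult.commute)
  finally show ?thesis by (rule mult_right_le_imp_le) (use assms(1) in simp)
qed

lemma cosine_sum_by_parts_twice:
  fixes v :: "nat \<Rightarrow> real"
  shows "v 0 / 2 + (\<Sum>i<N. v (Suc i) * cos (2 * real (Suc i) * y))
    = (\<Sum>n<N. (v n - 2 * v (Suc n) + v (Suc (Suc n))) * fejer_sum (Suc n) y)
      + (v N - v (Suc N)) * fejer_sum N y + v N * (1/2 + (\<Sum>i<N. cos (2 * real (Suc i) * y)))"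
  by (induction N) (auto simp: fejer_sum_def algebra_simps)

text \<open>
  The second difference is a value of the second derivative of \<open>x powr (- p)\<close>, by the mean value
  theorem applied twice.
\<close>

lemma second_difference_powr_ge:
  assumes "0 < p"
  shows "p * (p + 1) * real (n + 3) powr (- p - 2)
    \<le> real (n + 1) powr (- p) - 2 * real (n + 2) powr (- p) + real (n + 3) powr (- p)"
proof -
  define g where "g = (\<lambda>x. (x + 1) powr (- p) - x powr (- p))"
  have "\<exists>z. real (n + 1) < z \<and> z < real (n + 2) \<and> g (real (n + 2)) - g (real (n + 1))
      = (real (n + 2) - real (n + 1)) * (- p * (z + 1) powr (- p - 1) - (- p) * z powr (- p - 1))"
    unfolding g_def by (intro MVT2) (auto intro!: derivative_eq_intros)
  then obtain z where z: "real (n + 1) < z" "z < real (n + 2)"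
    "g (real (n + 2)) - g (real (n + 1)) = - p * (z + 1) powr (- p - 1) - (- p) * z powr (- p - 1)"
    by auto
  have "\<exists>t. z < t \<and> t < z + 1 \<and> (- p * (z + 1) powr (- p - 1)) - (- p * z powr (- p - 1))
      = (z + 1 - z) * (- p * ((- p - 1) * t powr (- p - 1 - 1)))"
    using z by (intro MVT2) (auto intro!: derivative_eq_intros)
  then obtain t where t: "z < t" "t < z + 1"
    "(- p * (z + 1) powr (- p - 1)) - (- p * z powr (- p - 1)) = p * (p + 1) * t powr (- p - 2)"
    by (auto simp: algebra_simps)
  have "p * (p + 1) * real (n + 3) powr (- p - 2) \<le> p * (p + 1) * t powr (- p - 2)"
    using z t assms by (intro mult_left_mono powr_mono2') auto
  also have "\<dots> = g (real (n + 2)) - g (real (n + 1))" using z t by simp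
  also have "\<dots> = real (n + 1) powr (- p) - 2 * real (n + 2) powr (- p) + real (n + 3) powr (- p)"
    by (simp add: g_def algebra_simps)
  finally show ?thesis .
qed

text \<open>
  This is what two summations by parts make of the cosine series with coefficients
  \<open>n powr (- p)\<close>, \<open>n \<ge> 1\<close>, cut off at \<open>M\<close>.  All its terms are nonnegative, so that the contributions of
  different frequencies cannot cancel.
\<close>

definition fejer_energy :: "real \<Rightarrow> nat \<Rightarrow> real \<Rightarrow> real" where
  "fejer_energy p M y = (\<Sum>n<M. (real (n + 1) powr (- p) - 2 * real (n + 2) powr (- p) + real (n + 3) powr (- p))
      * fejer_sum (n + 2) y)"

lemma second_difference_powr_nonneg:
  assumes "0 < p"
  shows "0 \<le> real (n + 1) powr (- p) - 2 * real (n + 2) powr (- p) + real (n + 3) powr (- p)"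
  using assms by (intro order_trans[OF _ second_difference_powr_ge[OF assms]]) simp

lemma fejer_energy_nonneg:
  assumes "0 < p" "sin y \<noteq> 0"
  shows "0 \<le> fejer_energy p M y"
  unfolding fejer_energy_def
  by (intro sum_nonneg mult_nonneg_nonneg second_difference_powr_nonneg fejer_sum_nonneg assms)

text \<open>
  For \<open>n \<le> L\<close> the Fejer sum is of order \<open>n\<^sup>2\<close> and the second difference of the weights of order
  \<open>n powr (- p - 2)\<close>; their product has the order of the original weight.
\<close>

lemma power_sum_le_fejer_energy:
  assumes p: "0 < p" and b: "sin (pi * b) \<noteq> 0" "2 * real (Suc L) * nearest_int_dist b \<le> 1" and LM: "L \<le> M"
  shows "2 * p * (p + 1) / (pi\<^sup>2 * 3 powr (p + 2)) * power_sum p L \<le> fejer_energy p M (pi * b)"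
proof -
  let ?D = "\<lambda>n. real (n + 1) powr (- p) - 2 * real (n + 2) powr (- p) + real (n + 3) powr (- p)"
  have "2 * p * (p + 1) / (pi\<^sup>2 * 3 powr (p + 2)) * power_sum p L
      = (\<Sum>n<L. 2 * p * (p + 1) / (pi\<^sup>2 * 3 powr (p + 2)) * real (Suc n) powr (- p))"
    by (simp add: power_sum_def sum_distrib_left)
  also have "\<dots> \<le> (\<Sum>n<L. ?D n * fejer_sum (n + 2) (pi * b))"
  proof (rule sum_mono)
    fix n assume "n \<in> {..<L}"
    then have n: "n + 2 \<le> Suc L" by simp
    have "2 * real (n + 2) * nearest_int_dist b \<le> 2 * real (Suc L) * nearest_int_dist b"
      using n by (intro mult_right_mono mult_left_mono) (auto simp: nearest_int_dist_bounds)
    then have F: "2 * (real (n + 2))\<^sup>2 / pi\<^sup>2 \<le> fejer_sum (n + 2) (pi * b)"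
      using b by (intro fejer_sum_ge) auto
    have "real (Suc n) powr (- p - 2) * 3 powr (- p - 2) = (3 * real (Suc n)) powr (- p - 2)"
      by (subst powr_mult) (auto simp: mult.commute)
    also have "\<dots> \<le> real (n + 3) powr (- p - 2)"
      using p by (intro powr_mono2') auto
    finally have "p * (p + 1) * (real (Suc n) powr (- p - 2) * 3 powr (- p - 2)) \<le> p * (p + 1) * real (n + 3) powr (- p - 2)"
      using p by (intro mult_left_mono) auto
    also have "\<dots> \<le> ?D n" by (rule second_difference_powr_ge[OF p])
    finally have D: "p * (p + 1) * (real (Suc n) powr (- p - 2) * 3 powr (- p - 2)) \<le> ?D n" .
    have "2 * p * (p + 1) / (pi\<^sup>2 * 3 powr (p + 2)) * real (Suc n) powr (- p)
        = p * (p + 1) * (real (Suc n) powr (- p - 2) * 3 powr (- p - 2)) * (2 * (real (Suc n))\<^sup>2 / pi\<^sup>2)"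
    proof -
      have "real (Suc n) powr (- p) = real (Suc n) powr ((- p - 2) + 2)" by simp
      also have "\<dots> = real (Suc n) powr (- p - 2) * (real (Suc n))\<^sup>2"
        unfolding powr_add by (simp add: powr_numeral)
      finally have "real (Suc n) powr (- p) = real (Suc n) powr (- p - 2) * (real (Suc n))\<^sup>2" .
      moreover have "3 powr (- p - 2) = inverse (3 powr (p + 2) :: real)"
        using powr_minus[of "3::real" "p + 2"] by simp
      ultimately show ?thesis by (simp only: divide_inverse inverse_mult_distrib mult_ac)
    qed
    also have "\<dots> \<le> p * (p + 1) * (real (Suc n) powr (- p - 2) * 3 powr (- p - 2)) * (2 * (real (n + 2))\<^sup>2 / pi\<^sup>2)"
      using p by (intro mult_left_mono divide_right_mono power_mono) auto
    also have "\<dots> \<le> ?D n * fejer_sum (n + 2) (pi * b)"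
      using D F p second_difference_powr_nonneg[OF p, of n] by (intro mult_mono) auto
    finally show "2 * p * (p + 1) / (pi\<^sup>2 * 3 powr (p + 2)) * real (Suc n) powr (- p) \<le> ?D n * fejer_sum (n + 2) (pi * b)" .
  qed
  also have "\<dots> \<le> fejer_energy p M (pi * b)"
    unfolding fejer_energy_def using LM
    by (intro sum_mono2 mult_nonneg_nonneg second_difference_powr_nonneg fejer_sum_nonneg p b) auto
  finally show ?thesis .
qed

text \<open>
  The difference of the two sides is \<open>(c0 - c2) * w0 - 2 * (c1 - c2) * w1\<close>.  It is nonnegative because
  convexity of \<open>c\<close> gives \<open>c0 - c2 \<ge> 2 * (c1 - c2)\<close> and \<open>w\<close> decreases.
\<close>

lemma second_difference_mult_ge:
  fixes c0 c1 c2 w0 w1 w2 :: real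
  assumes "2 * c1 \<le> c0 + c2" "c2 \<le> c0" "0 \<le> w1" "w1 \<le> w0"
  shows "c2 * (w0 - 2 * w1 + w2) \<le> c0 * w0 - 2 * (c1 * w1) + c2 * w2"
proof -
  have "(c0 - c2) * w1 \<le> (c0 - c2) * w0" using assms by (intro mult_left_mono) auto
  moreover have "2 * (c1 - c2) * w1 \<le> (c0 - c2) * w1" using assms by (intro mult_right_mono) auto
  ultimately show ?thesis by (simp add: algebra_simps)
qed

text \<open>
  Truncating the weights abruptly would destroy positivity: for small \<open>p\<close> the partial sums of
  \<open>\<Sum> n powr (- p) * cos (n * y)\<close> are not bounded below uniformly in \<open>y\<close>.  Cesaro weights \<open>c\<close> taper the
  coefficients to zero while keeping them convex, hence all second differences nonnegative.
  The choice of \<open>N\<close> makes the Cesaro weights at least one half for all indices up to \<open>M + 3\<close>.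
\<close>

lemma fejer_energy_le_mollified_sum:
  fixes p y :: real and M N :: nat
  defines "c \<equiv> (\<lambda>i. max 0 (1 - real (Suc i) / real N))"
  assumes p: "0 < p" and y: "sin y \<noteq> 0" and N: "N = 2 * (M + 3)"
  shows "fejer_energy p M y / 2 \<le> 1 + (\<Sum>i<N. (c i * real (Suc i) powr (- p)) * cos (2 * real (Suc i) * y))"
proof -
  define w where "w = (\<lambda>i. real (Suc i) powr (- p))"
  \<comment> \<open>The value 2 at 0 is large enough to extend the convex sequence; half of it is the 1 in the claim.\<close>
  define v where "v = (\<lambda>n. case n of 0 \<Rightarrow> 2 | Suc i \<Rightarrow> c i * w i)"
  have Npos: "real N > 0" using N by simp
  have c0: "0 \<le> c i" and c1: "c i \<le> 1" for i by (auto simp: c_def)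
  have cdec: "c j \<le> c i" if "i \<le> j" for i j
    using that Npos unfolding c_def by (intro max.mono diff_mono divide_right_mono) auto
  have cconv: "2 * c (Suc i) \<le> c i + c (Suc (Suc i))" for i
  proof (cases "c (Suc i) = 0")
    case True then show ?thesis using c0[of i] c0[of "Suc (Suc i)"] by simp
  next
    case False
    then have "c (Suc i) = 1 - real (Suc (Suc i)) / real N" by (auto simp: c_def max_def)
    then have "2 * c (Suc i) = 2 * (1 - real (Suc (Suc i)) / real N)" by simp
    also have "\<dots> = (1 - real (Suc i) / real N) + (1 - real (Suc (Suc (Suc i))) / real N)"
      using Npos by (simp add: field_simps)
    also have "\<dots> \<le> c i + c (Suc (Suc i))"
      by (intro add_mono) (simp_all add: c_def)
    finally show ?thesis .
  qed
  have w0: "0 \<le> w i" and w1: "w i \<le> 1" and wdec: "w (Suc i) \<le> w i" for i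
    using p powr_mono2'[of "- p" 1 "real (Suc i)"] by (auto simp: w_def intro!: powr_mono2')
  have D2: "c (Suc (Suc i)) * (w i - 2 * w (Suc i) + w (Suc (Suc i))) \<le> v (Suc i) - 2 * v (Suc (Suc i)) + v (Suc (Suc (Suc i)))" for i
    unfolding v_def using second_difference_mult_ge[OF cconv[of i] cdec[of i "Suc (Suc i)"] w0 wdec] by simp
  have w_eq: "w i - 2 * w (Suc i) + w (Suc (Suc i)) = real (i + 1) powr (- p) - 2 * real (i + 2) powr (- p) + real (i + 3) powr (- p)" for i
    by (simp add: w_def add.commute eval_nat_numeral)
  have w2: "0 \<le> w i - 2 * w (Suc i) + w (Suc (Suc i))" for i
    unfolding w_eq by (rule second_difference_powr_nonneg[OF p])
  have D2_nonneg: "0 \<le> v n - 2 * v (Suc n) + v (Suc (Suc n))" for n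
  proof (cases n)
    case 0
    have "c 0 * w 0 \<le> 1 * 1" using c0 c1 w0 w1 by (intro mult_mono) auto
    moreover have "0 \<le> c 1 * w 1" using c0 w0 by simp
    ultimately show ?thesis by (simp add: v_def 0)
  next
    case (Suc i)
    then show ?thesis using D2[of i] mult_nonneg_nonneg[OF c0 w2, of "Suc (Suc i)" i] by simp
  qed
  have vN: "v N = 0" "v (Suc N) = 0"
    using N by (auto simp: v_def c_def max_def split: nat.split)
  have half: "1/2 \<le> c (Suc (Suc i))" if "i < M" for i
  proof -
    have "c (Suc (Suc M)) \<le> c (Suc (Suc i))" using that by (intro cdec) auto
    moreover have "1/2 \<le> c (Suc (Suc M))" using N by (auto simp: c_def field_simps intro!: max.coboundedI2)
    ultimately show ?thesis by linarith
  qed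
  have "fejer_energy p M y / 2 = (\<Sum>n<M. 1/2 * (w n - 2 * w (Suc n) + w (Suc (Suc n))) * fejer_sum (Suc (Suc n)) y)"
    unfolding fejer_energy_def w_eq by (simp add: sum_divide_distrib)
  also have "\<dots> \<le> (\<Sum>n<M. (v (Suc n) - 2 * v (Suc (Suc n)) + v (Suc (Suc (Suc n)))) * fejer_sum (Suc (Suc n)) y)"
    using half w2 by (intro sum_mono mult_right_mono fejer_sum_nonneg y order_trans[OF mult_right_mono D2]) auto
  also have "\<dots> \<le> (\<Sum>n<Suc M. (v n - 2 * v (Suc n) + v (Suc (Suc n))) * fejer_sum (Suc n) y)"
    unfolding sum.lessThan_Suc_shift using mult_nonneg_nonneg[OF D2_nonneg[of 0] fejer_sum_nonneg[OF y, of "Suc 0"]] by simp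
  also have "\<dots> \<le> (\<Sum>n<N. (v n - 2 * v (Suc n) + v (Suc (Suc n))) * fejer_sum (Suc n) y)"
    using N by (intro sum_mono2 mult_nonneg_nonneg D2_nonneg fejer_sum_nonneg y) auto
  also have "\<dots> = v 0 / 2 + (\<Sum>i<N. v (Suc i) * cos (2 * real (Suc i) * y))"
    unfolding cosine_sum_by_parts_twice by (simp add: vN)
  also have "\<dots> = 1 + (\<Sum>i<N. (c i * real (Suc i) powr (- p)) * cos (2 * real (Suc i) * y))"
    by (simp add: v_def w_def)
  finally show ?thesis .
qed

text \<open>
  If the sine series converges, its Cesaro means are bounded.  By the Fourier expansion these means
  are, up to a bounded alternating sum and with a negative factor, the sum over all frequencies of the
  tapered cosine sums.  Each of those is at least \<open>- 1\<close> plus half a Fejer energy, and the \<open>- 1\<close>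
  costs only \<open>\<Sum> 1 / (4 k\<^sup>2 - 1) = 1 / 2\<close> altogether.
\<close>

lemma fejer_energy_sum_bounded:
  fixes \<alpha> p :: real
  assumes irr: "\<alpha> \<notin> \<rat>" and p: "0 < p"
    and summ: "summable (\<lambda>i. (- 1) ^ Suc i * \<bar>sin (real (Suc i) * pi * \<alpha>)\<bar> / real (Suc i) powr p)"
  shows "\<exists>B. \<forall>K M. finite K \<longrightarrow>
    (\<Sum>k\<in>K. fejer_energy p M (pi * (real (Suc k) * \<alpha> + 1/2)) / (4 * (real (Suc k))\<^sup>2 - 1)) \<le> B"
proof -
  define y where "y = (\<lambda>k. pi * (real (Suc k) * \<alpha> + 1/2))"
  define w where "w = (\<lambda>i. real (Suc i) powr (- p))"
  define s where "s = (\<lambda>i. (- 1) ^ Suc i * \<bar>sin (real (Suc i) * pi * \<alpha>)\<bar>)"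
  define D where "D = (\<lambda>k. 4 * (real (Suc k))\<^sup>2 - 1)"
  have D: "0 < D k" for k unfolding D_def by (rule four_square_minus_one_pos)
  have ws: "(- 1) ^ Suc i * \<bar>sin (real (Suc i) * pi * \<alpha>)\<bar> / real (Suc i) powr p = w i * s i" for i
    by (simp add: w_def s_def powr_minus field_simps)
  have "Bseq (\<lambda>m. \<Sum>i<m. w i * s i)"
    using summ unfolding ws by (intro convergent_imp_Bseq) (simp add: summable_iff_convergent)
  then obtain B0 where B0: "\<And>m. \<bar>\<Sum>i<m. w i * s i\<bar> \<le> B0" unfolding Bseq_def by auto
  have sumD: "(\<lambda>k. 1 / D k) sums (1/2)"
    using abs_sin_cosine_series[of 0] by (simp add: D_def)
  have "(\<Sum>k\<in>K. fejer_energy p M (y k) / D k) \<le> 2 * (1 + pi / 4 * B0)" if K: "finite K" for K M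
  proof -
    define N where "N = 2 * (M + 3)"
    define c where "c = (\<lambda>i. max 0 (1 - real (Suc i) / real N))"
    define V where "V = (\<lambda>k. \<Sum>i<N. (c i * w i) * cos (2 * real (Suc i) * y k))"
    have c0: "0 \<le> c i" and c1: "c i \<le> 1" for i by (auto simp: c_def)
    have cdec: "c (Suc i) \<le> c i" for i
      unfolding c_def N_def by (intro max.mono diff_mono divide_right_mono) auto
    have w0: "0 \<le> w i" and w1: "w i \<le> 1" and wdec: "w (Suc i) \<le> w i" for i
      using p powr_mono2'[of "- p" 1 "real (Suc i)"] by (auto simp: w_def intro!: powr_mono2')
    have X: "\<bar>\<Sum>i<N. c i * (w i * s i)\<bar> \<le> B0"
    proof -
      have "\<bar>\<Sum>i<N. c i * (w i * s i)\<bar> \<le> c 0 * B0"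
        by (intro abel_partial_sum_bound cdec c0 B0)
      also have "\<dots> \<le> 1 * B0" using c1 B0[of 0] by (intro mult_right_mono) auto
      finally show ?thesis by simp
    qed
    have Y: "\<bar>\<Sum>i<N. (c i * w i) * (- 1) ^ Suc i\<bar> \<le> 1"
    proof -
      have "\<bar>\<Sum>i<N. (c i * w i) * (- 1) ^ Suc i\<bar> \<le> (c 0 * w 0) * 1"
        using cdec c0 wdec w0 abs_sum_alternating_le
        by (intro abel_partial_sum_bound mult_mono mult_nonneg_nonneg) auto
      also have "\<dots> \<le> 1 * 1 * 1" using c0 c1 w0 w1 by (intro mult_mono) auto
      finally show ?thesis by simp
    qed
    have "(\<lambda>k. V k / D k) sums ((\<Sum>i<N. (c i * w i) * (- 1) ^ Suc i) / 2 - pi / 4 * (\<Sum>i<N. (c i * w i) * s i))"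
      unfolding V_def D_def s_def y_def by (rule shifted_fourier_expansion)
    from sums_add[OF sumD this]
    have S: "(\<lambda>k. (1 + V k) / D k) sums
       (1/2 + ((\<Sum>i<N. (c i * w i) * (- 1) ^ Suc i) / 2 - pi / 4 * (\<Sum>i<N. (c i * w i) * s i)))"
      by (simp add: add_divide_distrib)
    have low: "fejer_energy p M (y k) / 2 \<le> 1 + V k" for k
      unfolding V_def w_def c_def y_def
      by (intro fejer_energy_le_mollified_sum p sin_pi_mult_nonzero irrational_shift irr) (simp add: N_def)
    have nonneg: "0 \<le> fejer_energy p M (y k) / 2" for k
      unfolding y_def by (simp add: fejer_energy_nonneg[OF p sin_pi_mult_nonzero[OF irrational_shift[OF irr]]] del: of_nat_Suc)
    have "(\<Sum>k\<in>K. fejer_energy p M (y k) / 2 / D k) \<le> (\<Sum>k\<in>K. (1 + V k) / D k)"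
      using low D by (intro sum_mono divide_right_mono) (auto simp: less_imp_le)
    also have "\<dots> \<le> (\<Sum>k. (1 + V k) / D k)"
      using order_trans[OF nonneg low] D by (intro sum_le_suminf[OF sums_summable[OF S] K]) (auto simp: less_imp_le)
    also have "\<dots> \<le> 1 + pi / 4 * B0"
    proof -
      have "- (pi / 4 * (\<Sum>i<N. (c i * w i) * s i)) \<le> pi / 4 * B0"
        using X mult_left_mono[of "- (\<Sum>i<N. (c i * w i) * s i)" B0 "pi / 4"] by (simp add: mult.assoc abs_le_iff)
      then show ?thesis using Y unfolding sums_unique[OF S, symmetric] by linarith
    qed
    finally have "(\<Sum>k\<in>K. fejer_energy p M (y k) / D k) / 2 \<le> 1 + pi / 4 * B0"
      by (simp add: sum_divide_distrib field_simps)
    from mult_left_mono[OF this, of 2] show ?thesis by simp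
  qed
  then show ?thesis unfolding y_def D_def by blast
qed

section \<open>Best approximations\<close>

locale best_approximation_sequence =
  fixes \<alpha> :: real and a :: "nat \<Rightarrow> int" and q :: "nat \<Rightarrow> nat"
  assumes irrational: "\<alpha> \<notin> \<rat>" and best: "best_approximations \<alpha> a q"
begin

definition err :: "nat \<Rightarrow> real" where
  "err n = \<bar>real (q n) * \<alpha> - of_int (a n)\<bar>"

lemma q_1: "q 1 = 1" and q_less: "1 \<le> n \<Longrightarrow> q n < q (Suc n)"
  using best by (auto simp: best_approximations_def)

lemma q_ge: "1 \<le> n \<Longrightarrow> n \<le> q n"
proof (induction n rule: dec_induct)
  case base then show ?case using q_1 by simp
next
  case (step n) then show ?case using q_less[of n] by simp
qed

lemma q_pos: "1 \<le> n \<Longrightarrow> 0 < q n"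
  using q_ge[of n] by simp

lemma q_strict_mono: "1 \<le> m \<Longrightarrow> m < n \<Longrightarrow> q m < q n"
proof (induction n)
  case (Suc n)
  then show ?case using q_less[of n] by (cases "m = n") (auto intro: less_trans)
qed simp

lemma err_eq: "1 \<le> n \<Longrightarrow> err n = nearest_int_dist (real (q n) * \<alpha>)"
  using best by (auto simp: best_approximations_def err_def)

lemma err_le:
  assumes "1 \<le> n" "0 < k" "k < q (Suc n)"
  shows "err n \<le> nearest_int_dist (real k * \<alpha>)"
proof -
  have "2 \<le> Suc n" using assms by simp
  then have "Min ((\<lambda>k. nearest_int_dist (real k * \<alpha>)) ` {0<..<q (Suc n)}) = nearest_int_dist (real (q n) * \<alpha>)"
    using best unfolding best_approximations_def by (metis diff_Suc_1)
  then show ?thesis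
    using assms err_eq[of n] Min_le[of "(\<lambda>k. nearest_int_dist (real k * \<alpha>)) ` {0<..<q (Suc n)}" "nearest_int_dist (real k * \<alpha>)"]
    by simp
qed

lemma err_decreasing: "1 \<le> n \<Longrightarrow> err (Suc n) < err n"
  using best err_eq[of n] err_eq[of "Suc n"] unfolding best_approximations_def
  by (metis diff_Suc_1 le_SucI Suc_le_mono one_add_one plus_1_eq_Suc)

text \<open>
  A common divisor \<open>d > 1\<close> would give the smaller denominator \<open>q n div d\<close> with an error no larger.
\<close>

lemma coprime_a_q:
  assumes "1 \<le> n" shows "coprime (a n) (int (q n))"
proof (rule ccontr)
  assume nc: "\<not> coprime (a n) (int (q n))"
  define d where "d = gcd (a n) (int (q n))"
  have qn: "0 < q n" using q_pos assms by simp
  have "d > 0" using qn by (auto simp: d_def)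
  moreover have "d \<noteq> 1" using nc by (auto simp: d_def coprime_iff_gcd_eq_1)
  ultimately have d: "d > 1" by linarith
  obtain a' where a': "a n = d * a'" by (metis d_def dvd_def gcd_dvd1)
  obtain q' where q': "int (q n) = d * q'" by (metis d_def dvd_def gcd_dvd2)
  have "q' > 0" using q' qn d by (metis of_nat_0_less_iff zero_less_mult_pos order.strict_trans zero_less_one)
  moreover from this have "q' < int (q n)" using q' d by simp
  ultimately have k: "0 < nat q'" "nat q' < q n" by auto
  have "n \<noteq> 1" using k q_1 by auto
  then obtain m where m: "n = Suc m" "1 \<le> m" using assms by (cases n) auto
  have "err m \<le> nearest_int_dist (real (nat q') * \<alpha>)" using err_le[of m "nat q'"] k m by simp
  also have "\<dots> \<le> \<bar>real (nat q') * \<alpha> - of_int a'\<bar>" by (rule nearest_int_dist_le)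
  also have "\<dots> \<le> of_int d * \<bar>real (nat q') * \<alpha> - of_int a'\<bar>"
    using d mult_right_mono[of 1 "of_int d" "\<bar>real (nat q') * \<alpha> - of_int a'\<bar>"] by simp
  also have "\<dots> = err n"
  proof -
    have "real (q n) = of_int d * real (nat q')"
      using q' \<open>q' > 0\<close> by (metis of_int_mult of_int_of_nat_eq of_nat_nat less_imp_le)
    then have "real (q n) * \<alpha> - of_int (a n) = of_int d * (real (nat q') * \<alpha> - of_int a')"
      by (simp add: a' algebra_simps)
    then show ?thesis using d by (simp add: err_def abs_mult)
  qed
  finally show False using err_decreasing[of m] m by simp
qed

lemma err_le_inverse:
  assumes "1 \<le> n" shows "err n * (real (q (Suc n)) - 1) \<le> 1"
proof -
  define N where "N = q (Suc n) - 1"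
  have N: "N > 0" "real N = real (q (Suc n)) - 1" "N < q (Suc n)"
    using q_less[OF assms] q_pos[OF assms] by (auto simp: N_def)
  obtain h k where k: "0 < k" "k \<le> int N" and hk: "\<bar>of_int k * \<alpha> - of_int h\<bar> < 1 / real N"
    using Dirichlet_approx[OF N(1)] by metis
  have "err n \<le> nearest_int_dist (real (nat k) * \<alpha>)"
    using k N(3) assms by (intro err_le) auto
  also have "\<dots> \<le> \<bar>of_int k * \<alpha> - of_int h\<bar>"
    using nearest_int_dist_le[of "real (nat k) * \<alpha>" h] k by simp
  also note hk
  finally show ?thesis using N by (simp add: field_simps)
qed

text \<open>
  Consecutive approximations have a nonzero integer determinant, which is at most
  \<open>q (Suc n) * err n + q n * err (Suc n)\<close>.
\<close>

lemma err_ge_inverse: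
  assumes "1 \<le> n" shows "1 \<le> 2 * real (q (Suc n)) * err n"
proof -
  define D where "D = a n * int (q (Suc n)) - a (Suc n) * int (q n)"
  have "D \<noteq> 0"
  proof
    assume "D = 0"
    then have "int (q (Suc n)) dvd a (Suc n) * int (q n)" by (auto simp: D_def) (metis dvd_triv_right)
    then have "int (q (Suc n)) dvd int (q n)"
      using coprime_a_q[of "Suc n"] by (simp add: coprime_commute coprime_dvd_mult_right_iff)
    then show False using q_less[OF assms] q_pos[OF assms] by (simp add: nat_dvd_not_less)
  qed
  then have "1 \<le> \<bar>D\<bar>" by simp
  then have "1 \<le> \<bar>of_int D :: real\<bar>" by linarith
  also have "of_int D = real (q n) * (real (q (Suc n)) * \<alpha> - of_int (a (Suc n)))
      - real (q (Suc n)) * (real (q n) * \<alpha> - of_int (a n))"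
    by (simp add: D_def algebra_simps)
  also have "\<bar>\<dots>\<bar> \<le> real (q n) * err (Suc n) + real (q (Suc n)) * err n"
    unfolding err_def by (rule order_trans[OF abs_triangle_ineq4]) (simp add: abs_mult)
  also have "\<dots> \<le> real (q (Suc n)) * err n + real (q (Suc n)) * err n"
    using q_less[OF assms] err_decreasing[OF assms]
    by (intro add_mono mult_mono) (auto simp: err_def)
  finally show ?thesis by simp
qed

text \<open>
  A form of Legendre's criterion in which \<open>b\<close> and \<open>m\<close> may have a common factor, which is then \<open>j\<close>.  If
  \<open>q n \<le> m < q (Suc n)\<close>, the integer \<open>b * q n - a n * m\<close> has absolute value less than 1.
\<close>

lemma very_good_approximation_is_multiple:
  assumes m: "0 < m" and close: "real m * \<bar>real m * \<alpha> - of_int b\<bar> < 1/2"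
  obtains n j where "1 \<le> n" "1 \<le> j" "m = j * q n" "b = int j * a n"
proof -
  define n where "n = (LEAST i. m < q (Suc i))"
  have "m < q (Suc m)" using q_ge[of "Suc m"] by simp
  then have upper: "m < q (Suc n)" unfolding n_def by (rule LeastI)
  have "n \<noteq> 0" using upper q_1 m by (cases n) auto
  then obtain i where i: "n = Suc i" by (cases n) auto
  have lower: "q n \<le> m" using not_less_Least[of i "\<lambda>i. m < q (Suc i)"] i by (simp add: n_def)
  have n: "1 \<le> n" using i by simp
  have "err n \<le> \<bar>real m * \<alpha> - of_int b\<bar>"
    using err_le[OF n m upper] nearest_int_dist_le[of "real m * \<alpha>" b] by linarith
  have "\<bar>of_int (b * int (q n) - a n * int m)\<bar> = \<bar>real m * (real (q n) * \<alpha> - of_int (a n)) - real (q n) * (real m * \<alpha> - of_int b)\<bar>"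
    by (simp add: algebra_simps)
  also have "\<dots> \<le> real m * err n + real (q n) * \<bar>real m * \<alpha> - of_int b\<bar>"
    unfolding err_def by (rule order_trans[OF abs_triangle_ineq4]) (simp add: abs_mult)
  also have "\<dots> \<le> real m * \<bar>real m * \<alpha> - of_int b\<bar> + real m * \<bar>real m * \<alpha> - of_int b\<bar>"
    using \<open>err n \<le> _\<close> lower by (intro add_mono mult_mono) (auto simp: err_def)
  also have "\<dots> < 1" using close by simp
  finally have eq: "b * int (q n) = a n * int m" by linarith
  then have "int (q n) dvd a n * int m" by (metis dvd_triv_right)
  then have "int (q n) dvd int m"
    using coprime_a_q[OF n] by (simp add: coprime_commute coprime_dvd_mult_right_iff)
  then obtain j where j: "m = j * q n" by (metis dvd_def int_dvd_int_iff mult.commute)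
  have "b * int (q n) = (int j * a n) * int (q n)" using eq unfolding j by (simp only: of_nat_mult mult_ac)
  moreover have "int (q n) \<noteq> 0" using q_pos[OF n] by simp
  ultimately have "b = int j * a n" using mult_right_cancel by blast
  moreover have "1 \<le> j" using j m by (cases j) auto
  ultimately show ?thesis using that n j by blast
qed

text \<open>
  The numerator belonging to an even denominator is odd, so half the approximation error appears as a
  distance from a half-integer.
\<close>

lemma nearest_int_dist_half_denominator:
  assumes n: "1 \<le> n" and ev: "even (q n)"
  shows "2 * nearest_int_dist (real (q n div 2) * \<alpha> + 1/2) \<le> err n"
proof -
  have "odd (a n)" using coprime_common_divisor[OF coprime_a_q[OF n], of 2] ev by auto
  then obtain c where c: "a n = 2 * c + 1" by (auto elim: oddE)
  have "real (q n) = 2 * real (q n div 2)" using ev by auto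
  then have "real (q n) * \<alpha> - of_int (a n) = 2 * (real (q n div 2) * \<alpha> + 1/2 - of_int (c + 1))"
    by (simp add: c algebra_simps)
  then have "err n = 2 * \<bar>real (q n div 2) * \<alpha> + 1/2 - of_int (c + 1)\<bar>"
    by (simp only: err_def abs_mult abs_numeral)
  then show ?thesis
    using mult_left_mono[OF nearest_int_dist_le, of 2 "real (q n div 2) * \<alpha> + 1/2" "c + 1"] by (simp only:)
qed

text \<open>
  With \<open>m = 2 * Suc k\<close>, an odd integer \<open>b\<close> closer to \<open>m * \<alpha>\<close> than \<open>1 / (2 * m)\<close> forces
  \<open>m = j * q n\<close> and \<open>b = j * a n\<close>.  Parity then makes \<open>j\<close> odd and \<open>q n\<close> even.
\<close>

lemma nearest_int_dist_half_dichotomy: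
  fixes k :: nat
  defines "\<delta> \<equiv> nearest_int_dist (real (Suc k) * \<alpha> + 1/2)"
  shows "1 \<le> real (8 * Suc k) * \<delta> \<or>
    (\<exists>n j. 1 \<le> n \<and> 1 \<le> j \<and> even (q n) \<and> 2 * Suc k = j * q n \<and> 1 \<le> real (4 * q (Suc n)) * \<delta>)"
proof (cases "1 \<le> real (8 * Suc k) * \<delta>")
  case False
  define r where "r = round (real (Suc k) * \<alpha> + 1/2)"
  define b where "b = 2 * r - 1"
  have "real (2 * Suc k) * \<alpha> - of_int b = 2 * (real (Suc k) * \<alpha> + 1/2 - of_int r)"
    by (simp add: b_def algebra_simps)
  then have dist: "\<bar>real (2 * Suc k) * \<alpha> - of_int b\<bar> = 2 * \<delta>"
    by (simp only: \<delta>_def nearest_int_dist_eq_round r_def abs_mult abs_numeral)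
  have "real (2 * Suc k) * \<bar>real (2 * Suc k) * \<alpha> - of_int b\<bar> < 1/2"
    unfolding dist using False by (simp add: algebra_simps)
  then obtain n j where n: "1 \<le> n" and j: "1 \<le> j" and m: "2 * Suc k = j * q n" and b: "b = int j * a n"
    using very_good_approximation_is_multiple[of "2 * Suc k" b] by auto
  have "odd b" by (simp add: b_def)
  then have "odd j" using b by auto
  moreover have "even (j * q n)" unfolding m[symmetric] by simp
  ultimately have ev: "even (q n)" by simp
  have "real (2 * Suc k) * \<alpha> - of_int b = real j * (real (q n) * \<alpha> - of_int (a n))"
    unfolding m b by (simp add: algebra_simps)
  then have "2 * \<delta> = real j * err n" by (simp add: dist[symmetric] err_def abs_mult)
  also have "\<dots> \<ge> 1 * err n" using j by (intro mult_right_mono) (auto simp: err_def)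
  finally have "err n \<le> 2 * \<delta>" by simp
  then have "2 * real (q (Suc n)) * err n \<le> 2 * real (q (Suc n)) * (2 * \<delta>)"
    by (intro mult_left_mono) auto
  then have "1 \<le> real (4 * q (Suc n)) * \<delta>" using err_ge_inverse[OF n] by (simp add: algebra_simps)
  then show ?thesis using n j ev m by blast
qed simp

end

lemma integral_powr_bounds:
  fixes p :: real
  assumes p: "0 \<le> p" and Q: "1 \<le> Q"
  shows "power_sum p Q - 1 \<le> integral {1..real Q} (\<lambda>x. x powr (- p))"
    and "integral {1..real Q} (\<lambda>x. x powr (- p)) \<le> power_sum p (Q - 1)"
proof -
  have "power_sum p Q - 1 \<le> integral {1..real Q} (\<lambda>x. x powr (- p)) \<and>
      integral {1..real Q} (\<lambda>x. x powr (- p)) \<le> power_sum p (Q - 1)"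
    using Q
  proof (induction Q rule: dec_induct)
    case base
    then show ?case by (simp add: power_sum_def)
  next
    case (step Q)
    let ?f = "\<lambda>x::real. x powr (- p)"
    have int: "?f integrable_on {c..d}" if "1 \<le> c" for c d
      using that by (intro integrable_continuous_interval continuous_intros) auto
    have split: "integral {1..real (Suc Q)} ?f = integral {1..real Q} ?f + integral {real Q..real (Suc Q)} ?f"
      using step by (intro Henstock_Kurzweil_Integration.integral_combine[symmetric] int) auto
    have "integral {real Q..real (Suc Q)} ?f \<le> integral {real Q..real (Suc Q)} (\<lambda>_. real Q powr (- p))"
      using step p by (intro integral_le int) (auto intro!: powr_mono2')
    then have up: "integral {real Q..real (Suc Q)} ?f \<le> real Q powr (- p)" by simp
    have "integral {real Q..real (Suc Q)} (\<lambda>_. real (Suc Q) powr (- p)) \<le> integral {real Q..real (Suc Q)} ?f"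
      using step p by (intro integral_le int) (auto intro!: powr_mono2')
    then have lo: "real (Suc Q) powr (- p) \<le> integral {real Q..real (Suc Q)} ?f" by simp
    have "power_sum p (Suc Q - 1) = power_sum p (Q - 1) + real Q powr (- p)"
      using step by (cases Q) (auto simp: power_sum_def)
    moreover have "power_sum p (Suc Q) = power_sum p Q + real (Suc Q) powr (- p)"
      by (simp add: power_sum_def)
    ultimately show ?case using step split up lo by linarith
  qed
  then show "power_sum p Q - 1 \<le> integral {1..real Q} (\<lambda>x. x powr (- p))"
    and "integral {1..real Q} (\<lambda>x. x powr (- p)) \<le> power_sum p (Q - 1)" by auto
qed

section \<open>The two implications\<close>

context best_approximation_sequence
begin

definition gap_term :: "real \<Rightarrow> nat \<Rightarrow> real" where
  "gap_term p n = (if n \<in> large_gap_even_indices q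
     then 1 / (real (q n))\<^sup>2 * integral {1..real (q (n + 1))} (\<lambda>x. x powr (- p)) else 0)"

lemma gap_term_nonneg: "0 \<le> gap_term p n"
proof -
  have "(\<lambda>x::real. x powr (- p)) integrable_on {1..real (q (n + 1))}"
    by (intro integrable_continuous_interval continuous_intros) auto
  then have "0 \<le> integral {1..real (q (n + 1))} (\<lambda>x. x powr (- p))"
    by (rule Henstock_Kurzweil_Integration.integral_nonneg) auto
  then show ?thesis by (simp add: gap_term_def)
qed

text \<open>
  The frequency with index \<open>q n div 2\<close> lies within about \<open>1 / (2 * q (Suc n))\<close> of an integer, so its
  Fejer energy reaches the power sum up to \<open>q (Suc n)\<close>.  The index is shifted by one because
  frequencies are counted from \<open>Suc 0\<close>.
\<close>

lemma gap_term_le_fejer_energy: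
  assumes p: "0 < p" and n: "n \<in> large_gap_even_indices q" and M: "q (Suc n) \<le> M"
  shows "p * (p + 1) / (pi\<^sup>2 * 3 powr (p + 2)) * gap_term p n
    \<le> fejer_energy p M (pi * (real (Suc (q n div 2 - 1)) * \<alpha> + 1/2)) / (4 * (real (Suc (q n div 2 - 1)))\<^sup>2 - 1)"
proof -
  define k where "k = q n div 2 - 1"
  define \<beta> where "\<beta> = real (Suc k) * \<alpha> + 1/2"
  define c where "c = 2 * p * (p + 1) / (pi\<^sup>2 * 3 powr (p + 2))"
  define Q where "Q = q (Suc n)"
  from n have n1: "1 \<le> n" and ev: "even (q n)" and gap: "2 * q n \<le> Q"
    by (auto simp: large_gap_even_indices_def Q_def)
  have "2 \<le> q n" using ev q_pos[OF n1] by (cases "q n = 1") auto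
  then have k: "Suc k = q n div 2" "real (q n) = 2 * real (Suc k)" using ev by (auto simp: k_def)
  have Q: "4 \<le> Q" using gap \<open>2 \<le> q n\<close> by simp
  have c: "0 < c" using p by (simp add: c_def)
  have "2 * nearest_int_dist \<beta> \<le> err n"
    unfolding \<beta>_def k(1) by (rule nearest_int_dist_half_denominator[OF n1 ev])
  then have "(2 * nearest_int_dist \<beta>) * (real Q - 1) \<le> err n * (real Q - 1)"
    using Q by (intro mult_right_mono) auto
  also have "\<dots> \<le> 1" using err_le_inverse[OF n1] by (simp add: Q_def)
  finally have near: "2 * real (Suc (Q - 2)) * nearest_int_dist \<beta> \<le> 1"
    using Q by (simp add: of_nat_diff algebra_simps)
  have "integral {1..real Q} (\<lambda>x. x powr (- p)) \<le> power_sum p (Q - 1)"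
    using p Q by (intro integral_powr_bounds) auto
  also have "\<dots> \<le> power_sum p (2 * (Q - 2))" using Q by (intro power_sum_mono) auto
  also have "\<dots> \<le> 2 * power_sum p (Q - 2)" using power_sum_mult_le[of p 2 "Q - 2"] p by simp
  finally have int: "integral {1..real Q} (\<lambda>x. x powr (- p)) \<le> 2 * power_sum p (Q - 2)" .
  have "c / 2 * gap_term p n = c / 2 * integral {1..real Q} (\<lambda>x. x powr (- p)) / (4 * (real (Suc k))\<^sup>2)"
    using n by (simp add: gap_term_def k(2) Q_def power_mult_distrib del: of_nat_Suc)
  also have "\<dots> \<le> c * power_sum p (Q - 2) / (4 * (real (Suc k))\<^sup>2)"
    using mult_left_mono[OF int, of "c / 2"] c by (intro divide_right_mono) auto
  also have "\<dots> \<le> c * power_sum p (Q - 2) / (4 * (real (Suc k))\<^sup>2 - 1)"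
    using c four_square_minus_one_pos[of k]
    by (intro divide_left_mono mult_nonneg_nonneg mult_pos_pos power_sum_nonneg) (auto simp del: of_nat_Suc)
  also have "\<dots> \<le> fejer_energy p M (pi * \<beta>) / (4 * (real (Suc k))\<^sup>2 - 1)"
  proof (intro divide_right_mono)
    show "c * power_sum p (Q - 2) \<le> fejer_energy p M (pi * \<beta>)"
      unfolding c_def using near M
      by (intro power_sum_le_fejer_energy p sin_pi_mult_nonzero)
         (auto simp: \<beta>_def Q_def intro!: irrational_shift irrational simp del: of_nat_Suc)
  qed (use four_square_minus_one_pos[of k] in linarith)
  finally show ?thesis by (simp add: c_def \<beta>_def k_def)
qed

text \<open>
  Distinct even denominators belong to distinct frequencies, so the bound for finite sets of
  frequencies bounds the partial sums over the denominators.
\<close>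

lemma summable_gap_terms_if:
  assumes p: "0 < p"
    and summ: "summable (\<lambda>i. (- 1) ^ Suc i * \<bar>sin (real (Suc i) * pi * \<alpha>)\<bar> / real (Suc i) powr p)"
  shows "summable (gap_term p)"
proof -
  define c where "c = p * (p + 1) / (pi\<^sup>2 * 3 powr (p + 2))"
  define T where "T = (\<lambda>M k. fejer_energy p M (pi * (real (Suc k) * \<alpha> + 1/2)) / (4 * (real (Suc k))\<^sup>2 - 1))"
  have c: "0 < c" using p by (simp add: c_def)
  obtain B where B: "\<And>K M. finite K \<Longrightarrow> (\<Sum>k\<in>K. T M k) \<le> B"
    using fejer_energy_sum_bounded[OF irrational p summ] unfolding T_def by blast
  have "(\<Sum>n\<le>N. gap_term p n) \<le> B / c" for N
  proof -
    define S where "S = {..N} \<inter> large_gap_even_indices q"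
    define h where "h = (\<lambda>n. q n div 2 - 1)"
    have S: "1 \<le> n" "even (q n)" "n \<le> N" if "n \<in> S" for n
      using that by (auto simp: S_def large_gap_even_indices_def)
    have "inj_on h S"
    proof (rule inj_onI)
      fix m n assume mn: "m \<in> S" "n \<in> S" "h m = h n"
      have q2: "2 \<le> q i" if "i \<in> S" for i
        using S[OF that] q_pos[of i] by (cases "q i = 1") auto
      have "1 \<le> q m div 2" "1 \<le> q n div 2" using q2[OF mn(1)] q2[OF mn(2)] by auto
      then have "q m div 2 = q n div 2" using mn(3) by (simp add: h_def)
      then have "q m = q n" using S mn by (metis dvd_mult_div_cancel)
      then show "m = n" using q_strict_mono S mn by (metis less_irrefl linorder_neqE_nat)
    qed
    have "c * (\<Sum>n\<le>N. gap_term p n) = (\<Sum>n\<in>S. c * gap_term p n)"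
      unfolding sum_distrib_left by (rule sum.mono_neutral_right) (auto simp: S_def gap_term_def)
    also have "\<dots> \<le> (\<Sum>n\<in>S. T (q (Suc N)) (h n))"
    proof (rule sum_mono)
      fix n assume n: "n \<in> S"
      have "q (Suc n) \<le> q (Suc N)"
        using S[OF n] q_strict_mono[of "Suc n" "Suc N"] by (cases "n = N") auto
      with n show "c * gap_term p n \<le> T (q (Suc N)) (h n)"
        unfolding c_def T_def h_def by (intro gap_term_le_fejer_energy p) (auto simp: S_def)
    qed
    also have "\<dots> = (\<Sum>k\<in>h ` S. T (q (Suc N)) k)"
      using \<open>inj_on h S\<close> by (simp add: sum.reindex)
    also have "\<dots> \<le> B" by (rule B) (simp add: S_def)
    finally show ?thesis using c by (simp add: field_simps)
  qed
  then show ?thesis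
    by (intro bounded_imp_summable gap_term_nonneg)
qed

text \<open>
  The dominating series arises with all even denominators, whatever the size of the gap after them.
\<close>

definition even_term :: "real \<Rightarrow> nat \<Rightarrow> real" where
  "even_term p n = (if 1 \<le> n \<and> even (q n) then power_sum p (q (Suc n)) / (real (q n))\<^sup>2 else 0)"

lemma even_term_nonneg: "0 \<le> even_term p n"
  by (simp add: even_term_def power_sum_nonneg)

text \<open>
  A small gap, \<open>q (Suc n) < 2 * q n\<close>, leaves a term at most of order \<open>q n powr (- 1 - p / 2)\<close>, and
  \<open>q n \<ge> n\<close>; so the small gaps always contribute a convergent series.
\<close>

lemma even_term_le:
  assumes p: "0 < p" "p \<le> 1"
  shows "even_term p n \<le> gap_term p n + 4 * real n powr (- 1 - p / 2)"
proof (cases "1 \<le> n \<and> even (q n)")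
  case True
  define x where "x = real (q n)"
  have x: "1 \<le> x" "real n \<le> x" using True q_pos[of n] q_ge[of n] by (auto simp: x_def)
  have pw: "x powr (- 1 - p / 2) \<le> real n powr (- 1 - p / 2)"
    using x True p by (intro powr_mono2') auto
  show ?thesis
  proof (cases "2 * q n \<le> q (Suc n)")
    case gap: True
    have "1 / x\<^sup>2 = x powr (- 2)" using x powr_minus[of x 2] by (simp add: powr_numeral inverse_eq_divide)
    also have "\<dots> \<le> x powr (- 1 - p / 2)" using x p by (intro powr_mono) auto
    finally have sq: "1 / x\<^sup>2 \<le> 4 * real n powr (- 1 - p / 2)"
      using pw powr_ge_zero[of "real n" "- 1 - p / 2"] by linarith
    have "power_sum p (q (Suc n)) \<le> integral {1..real (q (Suc n))} (\<lambda>x. x powr (- p)) + 1"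
      using integral_powr_bounds(1)[of p "q (Suc n)"] p q_pos[of "Suc n"] by simp
    then have "even_term p n \<le> (integral {1..real (q (Suc n))} (\<lambda>x. x powr (- p)) + 1) / x\<^sup>2"
      using True by (auto simp: even_term_def x_def intro!: divide_right_mono)
    also have "\<dots> = gap_term p n + 1 / x\<^sup>2"
      using True gap by (simp add: gap_term_def large_gap_even_indices_def x_def add_divide_distrib)
    finally show ?thesis using sq by linarith
  next
    case False
    have "power_sum p (q (Suc n)) \<le> power_sum p (2 * q n)"
      using False by (intro power_sum_mono) auto
    also have "\<dots> \<le> 2 * power_sum p (q n)" using power_sum_mult_le[of p 2 "q n"] p by simp
    also have "\<dots> \<le> 2 * (2 * x powr (1 - p / 2))"
      unfolding x_def by (intro mult_left_mono power_sum_le_powr p) auto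
    finally have "even_term p n \<le> 4 * x powr (1 - p / 2) / x\<^sup>2"
      using True by (auto simp: even_term_def x_def intro!: divide_right_mono)
    also have "\<dots> = 4 * x powr ((1 - p / 2) - 2)"
      using x by (subst powr_diff) (simp add: powr_numeral)
    also have "\<dots> = 4 * x powr (- 1 - p / 2)" by simp
    finally show ?thesis using pw gap_term_nonneg[of p n] by linarith
  qed
next
  case False
  then show ?thesis using gap_term_nonneg[of p n] by (auto simp: even_term_def)
qed

lemma summable_even_terms:
  assumes p: "0 < p" "p \<le> 1" and "summable (gap_term p)"
  shows "summable (even_term p)"
proof (rule summable_comparison_test')
  show "summable (\<lambda>n. gap_term p n + 4 * real n powr (- 1 - p / 2))"
    using assms summable_real_powr_iff[of "- 1 - p / 2"] by (intro summable_add summable_mult) auto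
  show "norm (even_term p n) \<le> gap_term p n + 4 * real n powr (- 1 - p / 2)" if "n \<ge> 0" for n
    using even_term_le[OF p, of n] even_term_nonneg[of p n] by simp
qed

text \<open>
  For most \<open>k\<close> the distance of the frequency from the integers is at least of order \<open>1 / k\<close>, and the
  term is of order \<open>k powr (- 1 - p / 2)\<close>.  The exceptional \<open>k\<close> are determined by a pair
  \<open>(n, j)\<close> with \<open>2 * Suc k = j * q n\<close> and \<open>q n\<close> even; their terms are bounded by the product of
  \<open>even_term p n\<close> and \<open>16 / j\<^sup>2\<close>, which is summable over all pairs.
\<close>

lemma summable_criterion_if_gap_terms:
  fixes L :: "nat \<Rightarrow> nat"
  assumes p: "0 < p" "p \<le> 1" and summ: "summable (gap_term p)"
    and L: "\<And>k M. 1 \<le> real M * nearest_int_dist (real (Suc k) * \<alpha> + 1/2) \<Longrightarrow> L k \<le> M"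
  shows "summable (\<lambda>k. power_sum p (L k) / (real (Suc k))\<^sup>2)"
proof -
  define h where "h = (\<lambda>k. power_sum p (L k) / (real (Suc k))\<^sup>2)"
  define good where "good = {k. L k \<le> 8 * Suc k}"
  define E where "E = suminf (even_term p)"
  define J where "J = (\<Sum>j. 1 / (real j)\<^sup>2)"
  define A where "A = (\<lambda>k. 16 * real (Suc k) powr (- 1 - p / 2))"
  have h_nonneg: "0 \<le> h k" for k by (simp add: h_def power_sum_nonneg)
  have even_summ: "summable (even_term p)" by (rule summable_even_terms[OF p summ])
  have sq_summ: "summable (\<lambda>j. 1 / (real j)\<^sup>2)"
    using inverse_power_summable[of 2, where 'a = real] by (simp add: inverse_eq_divide)
  have A_summ: "summable A"
    unfolding A_def
    using summable_real_powr_iff[of "- 1 - p / 2"] summable_Suc_iff[of "\<lambda>n. real n powr (- 1 - p / 2)"] p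
    by (intro summable_mult) auto
  have A_nonneg: "0 \<le> A k" for k by (simp add: A_def)
  have good_le: "h k \<le> A k" if "k \<in> good" for k
  proof -
    have "power_sum p (L k) \<le> power_sum p (8 * Suc k)"
      using that by (intro power_sum_mono) (auto simp: good_def)
    also have "\<dots> \<le> real 8 * power_sum p (Suc k)" using p by (intro power_sum_mult_le) auto
    also have "\<dots> \<le> real 8 * (2 * real (Suc k) powr (1 - p / 2))"
      by (intro mult_left_mono power_sum_le_powr p) auto
    finally have "h k \<le> real 8 * (2 * real (Suc k) powr (1 - p / 2)) / (real (Suc k))\<^sup>2"
      unfolding h_def by (intro divide_right_mono) auto
    also have "\<dots> = 16 * real (Suc k) powr ((1 - p / 2) - 2)"
      by (subst powr_diff) (simp add: powr_numeral del: of_nat_Suc)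
    also have "\<dots> = A k" by (simp add: A_def)
    finally show ?thesis .
  qed
  have "\<exists>n j. 1 \<le> n \<and> 1 \<le> j \<and> even (q n) \<and> 2 * Suc k = j * q n \<and> L k \<le> 4 * q (Suc n)"
    if "k \<notin> good" for k
    using nearest_int_dist_half_dichotomy[of k] L[where k = k] that unfolding good_def by blast
  then obtain n j where nj: "\<And>k. k \<notin> good \<Longrightarrow>
      1 \<le> n k \<and> 1 \<le> j k \<and> even (q (n k)) \<and> 2 * Suc k = j k * q (n k) \<and> L k \<le> 4 * q (Suc (n k))"
    by metis
  have bad_le: "h k \<le> 16 * (even_term p (n k) * (1 / (real (j k))\<^sup>2))" if "k \<notin> good" for k
  proof -
    note nj[OF that]
    then have "power_sum p (L k) \<le> power_sum p (4 * q (Suc (n k)))"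
      by (intro power_sum_mono) auto
    also have "\<dots> \<le> real 4 * power_sum p (q (Suc (n k)))" using p by (intro power_sum_mult_le) auto
    finally have "h k \<le> real 4 * power_sum p (q (Suc (n k))) / (real (Suc k))\<^sup>2"
      unfolding h_def by (intro divide_right_mono) auto
    also have "real (Suc k) = real (j k) * real (q (n k)) / 2"
    proof -
      have "2 * real (Suc k) = real (j k) * real (q (n k))"
        using nj[OF that] by (metis of_nat_mult of_nat_numeral)
      then show ?thesis by simp
    qed
    also have "real 4 * power_sum p (q (Suc (n k))) / (real (j k) * real (q (n k)) / 2)\<^sup>2
        = 16 * (even_term p (n k) * (1 / (real (j k))\<^sup>2))"
      using nj[OF that] by (simp add: even_term_def power_divide power_mult_distrib)
    finally show ?thesis .
  qed
  have "(\<Sum>k\<le>K. h k) \<le> suminf A + 16 * (E * J)" for K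
  proof -
    let ?bad = "{..K} - good"
    let ?box = "{..2 * Suc K} \<times> {..2 * Suc K}"
    have "(\<Sum>k\<le>K. h k) = (\<Sum>k\<in>{..K} \<inter> good. h k) + (\<Sum>k\<in>?bad. h k)"
      by (subst sum.Int_Diff[of _ _ good]) auto
    moreover have "(\<Sum>k\<in>{..K} \<inter> good. h k) \<le> (\<Sum>k\<in>{..K} \<inter> good. A k)"
      by (intro sum_mono good_le) auto
    moreover have "(\<Sum>k\<in>{..K} \<inter> good. A k) \<le> suminf A"
      by (intro sum_le_suminf A_summ A_nonneg) auto
    moreover have "(\<Sum>k\<in>?bad. h k) \<le> 16 * (E * J)"
    proof -
      have inj: "inj_on (\<lambda>k. (n k, j k)) ?bad"
      proof (rule inj_onI)
        fix k l assume kl: "k \<in> ?bad" "l \<in> ?bad" "(n k, j k) = (n l, j l)"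
        then have "2 * Suc k = 2 * Suc l" using nj[of k] nj[of l] by auto
        then show "k = l" by simp
      qed
      have sub: "(\<lambda>k. (n k, j k)) ` ?bad \<subseteq> ?box"
      proof (rule image_subsetI)
        fix k assume k: "k \<in> ?bad"
        then have *: "1 \<le> n k" "1 \<le> j k" "2 * Suc k = j k * q (n k)" using nj[of k] by auto
        have "n k \<le> q (n k)" using * q_ge by simp
        also have "\<dots> \<le> j k * q (n k)" using * by simp
        finally have "n k \<le> 2 * Suc k" using * by simp
        moreover have "j k \<le> j k * q (n k)" using q_pos[OF *(1)] by simp
        then have "j k \<le> 2 * Suc k" using * by simp
        ultimately show "(n k, j k) \<in> ?box" using k by auto
      qed
      have "(\<Sum>k\<in>?bad. h k) \<le> (\<Sum>k\<in>?bad. 16 * (even_term p (n k) * (1 / (real (j k))\<^sup>2)))"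
        by (intro sum_mono bad_le) auto
      also have "\<dots> = 16 * (\<Sum>(n, j)\<in>(\<lambda>k. (n k, j k)) ` ?bad. even_term p n * (1 / (real j)\<^sup>2))"
        by (simp add: sum.reindex[OF inj] sum_distrib_left)
      also have "\<dots> \<le> 16 * (\<Sum>(n, j)\<in>?box. even_term p n * (1 / (real j)\<^sup>2))"
        using sub even_term_nonneg by (intro mult_left_mono sum_mono2) auto
      also have "(\<Sum>(n, j)\<in>?box. even_term p n * (1 / (real j)\<^sup>2))
          = (\<Sum>n\<le>2 * Suc K. even_term p n) * (\<Sum>j\<le>2 * Suc K. 1 / (real j)\<^sup>2)"
        by (simp only: sum_product sum.cartesian_product)
      also have "16 * \<dots> \<le> 16 * (E * J)"
        unfolding E_def J_def
        by (intro mult_left_mono mult_mono sum_le_suminf even_summ sq_summ suminf_nonneg sum_nonneg even_term_nonneg) auto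
      finally show ?thesis by simp
    qed
    ultimately show ?thesis by linarith
  qed
  then have "summable h" by (intro bounded_imp_summable h_nonneg)
  then show ?thesis by (simp add: h_def)
qed

lemma summable_alternating_sine_if_gap_terms:
  assumes p: "0 < p" "p \<le> 1" and summ: "summable (gap_term p)"
  shows "summable (\<lambda>i. (- 1) ^ Suc i * \<bar>sin (real (Suc i) * pi * \<alpha>)\<bar> / real (Suc i) powr p)"
proof -
  define d where "d = (\<lambda>k. nearest_int_dist (real (Suc k) * \<alpha> + 1/2))"
  define L where "L = (\<lambda>k. nat \<lceil>1 / d k\<rceil>)"
  have d: "0 < d k" for k unfolding d_def by (intro nearest_int_dist_pos irrational_shift irrational)
  have L1: "1 \<le> real (L k) * d k" for k
  proof -
    have "1 / d k \<le> real (L k)" unfolding L_def by (rule real_nat_ceiling_ge)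
    then show ?thesis using d[of k] by (simp add: field_simps)
  qed
  have L2: "L k \<le> M" if "1 \<le> real M * d k" for k M
  proof -
    have "1 / d k \<le> real M" using that d[of k] by (simp add: field_simps)
    then show ?thesis by (simp add: L_def nat_le_iff ceiling_le_iff)
  qed
  have "summable (\<lambda>k. power_sum p (L k) / (real (Suc k))\<^sup>2)"
    by (rule summable_criterion_if_gap_terms[OF p summ]) (rule L2, simp add: d_def)
  then have "summable (\<lambda>k. power_sum p (L k) / (4 * (real (Suc k))\<^sup>2 - 1))"
  proof (rule summable_comparison_test')
    fix k :: nat
    have "1 \<le> (real (Suc k))\<^sup>2" by (rule one_le_power) simp
    then have "power_sum p (L k) / (4 * (real (Suc k))\<^sup>2 - 1) \<le> power_sum p (L k) / (real (Suc k))\<^sup>2"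
      by (intro divide_left_mono power_sum_nonneg mult_pos_pos) linarith+
    then show "norm (power_sum p (L k) / (4 * (real (Suc k))\<^sup>2 - 1)) \<le> power_sum p (L k) / (real (Suc k))\<^sup>2"
      using power_sum_nonneg[of p "L k"] four_square_minus_one_pos[of k]
      by (simp only: real_norm_def abs_divide abs_of_nonneg abs_of_pos)
  qed
  then show ?thesis
    by (intro summable_alternating_sine_if[OF irrational p(1), of L]) (use L1 in \<open>simp_all only: d_def\<close>)
qed

end

theorem theorem6:
  fixes \<alpha> p :: real and a :: "nat \<Rightarrow> int" and q :: "nat \<Rightarrow> nat"
  assumes "\<alpha> \<notin> \<rat>"
    and "best_approximations \<alpha> a q"
    and "0 < p" and "p \<le> 1"
  shows "summable (\<lambda>k. let n = Suc k in
             (-1) ^ n * \<bar>sin (real n * pi * \<alpha>)\<bar> / real n powr p)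
     \<longleftrightarrow> summable (\<lambda>n. if n \<in> large_gap_even_indices q
             then 1 / (real (q n))\<^sup>2 * integral {1..real (q (n + 1))} (\<lambda>x. x powr (- p))
             else 0)"
proof -
  interpret best_approximation_sequence \<alpha> a q
    using assms(1,2) by unfold_locales
  show ?thesis
    unfolding Let_def gap_term_def[symmetric]
    using summable_gap_terms_if[OF assms(3)] summable_alternating_sine_if_gap_terms[OF assms(3,4)] by blast
qed

end
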